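(* Let $n>1$, let $\lambda\in\Bbbk$ be a primitive $n$th root of unity, $H=H_n(\lambda)$, and let $\mu\in\Bbbk^\times$ have multiplicative order $n$. Let $A=\Bbbk_\mu[u,v]$ or $A=A_1^\mu$. Suppose $H$ acts linearly and inner faithfully on $A$, where the action has the form $$g(u)=\mu u,\quad g(v)=\lambda\mu v,\quad x(u)=0,\quad x(v)=\eta u\quad\text{for some }\eta\in\Bbbk^\times,$$ with $\lambda=\mu^{-2}$ in the case $A=A_1^\mu$. Then $$d(A\#H/A^H)=_{\Bbbk^\times}u^{2n^4(n-1)}.$$
   Context: $\Bbbk$ is an algebraically closed field of characteristic zero; all algebras are $\Bbbk$-algebras. $a=_{\Bbbk^\times}b$ means $a=cb$ for some $c\in\Bbbk^\times$. $\Bbbk_\mu[u,v]=\Bbbk\langle u,v\mid uv-\mu vu\rangle$ (quantum plane); $A_1^\mu=\Bbbk\langle u,v\mid uv-\mu vu-1\rangle$ (quantum Weyl algebra). The Taft algebra $H_n(\lambda)$ is the Hopf algebra generated by $g,x$ with relations $g^n=1$, $x^n=0$, $xg=\lambda gx$, and $\Delta(g)=g\otimes g$, $\Delta(x)=g\otimes x+x\otimes 1$, $\varepsilon(g)=1$, $\varepsilon(x)=0$, $S(g)=g^{n-1}$, $S(x)=-g^{n-1}x$. $H$ acts on $A$ if $A$ is a left $H$-module with $h\cdot 1=\varepsilon(h)1$ and $h\cdot(rr')=\sum(h_1\cdot r)(h_2\cdot r')$. The action is inner faithful if no nonzero Hopf ideal of $H$ annihilates $A$, and linear if $g(u),g(v),x(u),x(v)\in\Bbbk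 u+\Bbbk v$. The smash product $A\#H$ is $A\otimes H$ as a vector space, with multiplication $(r\#h)(r'\#h')=\sum r(h_1\cdot r')\#h_2h'$. $A^H=\{r\in A: h(r)=\varepsilon(h)r\ \forall h\in H\}$, identified with $A^H\#1$, a central subalgebra of $A\#H$ over which $A\#H$ is free of finite rank. Discriminant: if an algebra $B$ is free of finite rank $\omega$ over a central subalgebra $C$ with basis $z_1,\dots,z_\omega$, let $\mathrm{tr}:B\to M_\omega(C)\to C$ be left multiplication followed by the matrix trace; then $d(B/C)=\det(\mathrm{tr}(z_iz_j))_{i,j}\in C$, defined up to multiplication by units of $C$. *)

theory Defs
  imports
    "HOL-Library.Poly_Mapping"
    "HOL-Computational_Algebra.Polynomial"
    "HOL-Combinatorics.Permutations"
begin

section \<open>Algebras over a field and presentations\<close>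

text \<open>An associative unital (not necessarily commutative) algebra over the field \<^typ>\<open>'k\<close>.\<close>

locale k_algebra = vector_space scale
  for scale :: "'k::field \<Rightarrow> 'a::ring_1 \<Rightarrow> 'a" +
  assumes scale_mult_left: "scale c (a * b) = scale c a * b"
    and scale_mult_right: "scale c (a * b) = a * scale c b"

definition algebra_hom ::
  "('k::field \<Rightarrow> 'a::ring_1 \<Rightarrow> 'a) \<Rightarrow> ('k \<Rightarrow> 'b::ring_1 \<Rightarrow> 'b) \<Rightarrow> ('a \<Rightarrow> 'b) \<Rightarrow> bool" where
  "algebra_hom s t f \<longleftrightarrow>
     Vector_Spaces.linear s t f \<and> f 1 = 1 \<and> (\<forall>a b. f (a * b) = f a * f b)"

definition algebra_antihom ::
  "('k::field \<Rightarrow> 'a::ring_1 \<Rightarrow> 'a) \<Rightarrow> ('k \<Rightarrow> 'b::ring_1 \<Rightarrow> 'b) \<Rightarrow> ('a \<Rightarrow> 'b) \<Rightarrow> bool" where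
  "algebra_antihom s t f \<longleftrightarrow>
     Vector_Spaces.linear s t f \<and> f 1 = 1 \<and> (\<forall>a b. f (a * b) = f b * f a)"

text \<open>
  A formal linear combination \<^term>\<open>p :: 'x \<Rightarrow>\<^sub>0 'k\<close> evaluated along
  \<open>f\<close>: the linear extension of \<open>f\<close> to the free vector space on \<^typ>\<open>'x\<close>.
\<close>

definition lin_ext :: "('k \<Rightarrow> 'a \<Rightarrow> 'a) \<Rightarrow> ('x \<Rightarrow> 'a) \<Rightarrow> ('x \<Rightarrow>\<^sub>0 'k::field) \<Rightarrow> 'a::ab_group_add" where
  "lin_ext s f p = (\<Sum>x\<in>Poly_Mapping.keys p. s (Poly_Mapping.lookup p x) (f x))"

text \<open>
  The free monoid, written additively so that \<open>'g word \<Rightarrow>\<^sub>0 'k\<close> with the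
  convolution product of \<^theory>\<open>HOL-Library.Poly_Mapping\<close> is the free algebra on \<^typ>\<open>'g\<close>.
\<close>

datatype 'g word = Word (letters: "'g list")

instantiation word :: (type) monoid_add
begin

definition zero_word :: "'a word" where "0 = Word []"

definition plus_word :: "'a word \<Rightarrow> 'a word \<Rightarrow> 'a word"
  where "w + w' = Word (letters w @ letters w')"

instance
  by standard (simp_all add: zero_word_def plus_word_def)

end

type_synonym ('g, 'k) free_algebra = "'g word \<Rightarrow>\<^sub>0 'k"

definition gen :: "'g \<Rightarrow> ('g, 'k::field) free_algebra" where
  "gen x = Poly_Mapping.single (Word [x]) 1"

definition const :: "'k::field \<Rightarrow> ('g, 'k) free_algebra" where
  "const c = Poly_Mapping.single 0 c"

definition free_eval ::
  "('k::field \<Rightarrow> 'a::ring_1 \<Rightarrow> 'a) \<Rightarrow> ('g \<Rightarrow> 'a) \<Rightarrow> ('g, 'k) free_algebra \<Rightarrow> 'a" where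
  "free_eval s \<phi> = lin_ext s (\<lambda>w. prod_list (map \<phi> (letters w)))"

definition two_sided_ideal :: "'a::ring_1 set \<Rightarrow> bool" where
  "two_sided_ideal I \<longleftrightarrow>
     0 \<in> I \<and> (\<forall>a\<in>I. \<forall>b\<in>I. a + b \<in> I) \<and> (\<forall>a\<in>I. \<forall>r. r * a \<in> I \<and> a * r \<in> I)"

text \<open>
  The algebra \<^typ>\<open>'a\<close> is generated by the family \<open>\<phi>\<close> subject to the
  relations \<open>R\<close>: evaluation induces an isomorphism from the free algebra modulo
  the two-sided ideal generated by \<open>R\<close>.
\<close>

definition presented_by ::
  "('k::field \<Rightarrow> 'a::ring_1 \<Rightarrow> 'a) \<Rightarrow> ('g \<Rightarrow> 'a) \<Rightarrow> ('g, 'k) free_algebra set \<Rightarrow> bool" where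
  "presented_by s \<phi> R \<longleftrightarrow>
     k_algebra s \<and> surj (free_eval s \<phi>) \<and>
     {p. free_eval s \<phi> p = 0} = two_sided_ideal hull R"

datatype uv_gen = Gen_u | Gen_v

definition quantum_plane ::
  "'k::field \<Rightarrow> ('k \<Rightarrow> 'a::ring_1 \<Rightarrow> 'a) \<Rightarrow> 'a \<Rightarrow> 'a \<Rightarrow> bool" where
  "quantum_plane \<mu> s u v \<longleftrightarrow>
     presented_by s (case_uv_gen u v)
       {gen Gen_u * gen Gen_v - const \<mu> * gen Gen_v * gen Gen_u}"

definition quantum_weyl_algebra ::
  "'k::field \<Rightarrow> ('k \<Rightarrow> 'a::ring_1 \<Rightarrow> 'a) \<Rightarrow> 'a \<Rightarrow> 'a \<Rightarrow> bool" where
  "quantum_weyl_algebra \<mu> s u v \<longleftrightarrow>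
     presented_by s (case_uv_gen u v)
       {gen Gen_u * gen Gen_v - const \<mu> * gen Gen_v * gen Gen_u - 1}"


section \<open>Tensor products\<close>

definition tensor_relations ::
  "('k::field \<Rightarrow> 'v::ab_group_add \<Rightarrow> 'v) \<Rightarrow> ('k \<Rightarrow> 'w::ab_group_add \<Rightarrow> 'w)
     \<Rightarrow> ('v \<times> 'w \<Rightarrow>\<^sub>0 'k) set" where
  "tensor_relations s t =
     {Poly_Mapping.single (a + a', b) 1 - Poly_Mapping.single (a, b) 1
        - Poly_Mapping.single (a', b) 1 | a a' b. True} \<union>
     {Poly_Mapping.single (a, b + b') 1 - Poly_Mapping.single (a, b) 1
        - Poly_Mapping.single (a, b') 1 | a b b'. True} \<union>
     {Poly_Mapping.single (s c a, b) 1 - Poly_Mapping.single (a, b) c | c a b. True} \<union>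
     {Poly_Mapping.single (a, t c b) 1 - Poly_Mapping.single (a, b) c | c a b. True}"

text \<open>
  The space \<^typ>\<open>'t\<close>, with \<open>\<tau> a b\<close> in the role of \<open>a \<otimes> b\<close>, is the tensor product of two vector
  spaces: formal combinations of pairs modulo the bilinearity relations map
  isomorphically onto it.
\<close>

definition is_tensor_product ::
  "('k::field \<Rightarrow> 'v::ab_group_add \<Rightarrow> 'v) \<Rightarrow> ('k \<Rightarrow> 'w::ab_group_add \<Rightarrow> 'w)
     \<Rightarrow> ('k \<Rightarrow> 't::ab_group_add \<Rightarrow> 't) \<Rightarrow> ('v \<Rightarrow> 'w \<Rightarrow> 't) \<Rightarrow> bool" where
  "is_tensor_product s t sT \<tau> \<longleftrightarrow>
     vector_space sT \<and> surj (lin_ext sT (\<lambda>(a, b). \<tau> a b)) \<and>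
     {p. lin_ext sT (\<lambda>(a, b). \<tau> a b) p = 0} =
       module.span (\<lambda>c. Poly_Mapping.map ((*) c)) (tensor_relations s t)"


section \<open>Hopf algebra data and the Taft algebra\<close>

text \<open>
  The type \<^typ>\<open>'t\<close> carries the tensor square of the Hopf algebra \<^typ>\<open>'h\<close>; the
  two ring structures are those of the types.
\<close>

record ('k, 'h, 't) hopf =
  hscale :: "'k \<Rightarrow> 'h \<Rightarrow> 'h"
  tscale :: "'k \<Rightarrow> 't \<Rightarrow> 't"
  tensor :: "'h \<Rightarrow> 'h \<Rightarrow> 't"
  comult :: "'h \<Rightarrow> 't"
  counit :: "'h \<Rightarrow> 'k"
  antipode :: "'h \<Rightarrow> 'h"

definition tensor_square ::
  "('k::field, 'h::ring_1, 't::ring_1) hopf \<Rightarrow> bool" where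
  "tensor_square H \<longleftrightarrow>
     k_algebra (hscale H) \<and> k_algebra (tscale H) \<and>
     is_tensor_product (hscale H) (hscale H) (tscale H) (tensor H) \<and>
     tensor H 1 1 = 1 \<and>
     (\<forall>a b c d. tensor H a b * tensor H c d = tensor H (a * c) (b * d))"

datatype taft_gen = Gen_g | Gen_x

text \<open>
  The structure maps are determined by multiplicativity and their values on the
  generators; the Hopf algebra axioms then hold automatically and are not assumed.
\<close>

definition taft_algebra ::
  "nat \<Rightarrow> 'k::field \<Rightarrow> ('k, 'h::ring_1, 't::ring_1) hopf \<Rightarrow> 'h \<Rightarrow> 'h \<Rightarrow> bool" where
  "taft_algebra n lam H g x \<longleftrightarrow>
     presented_by (hscale H) (case_taft_gen g x)
       {gen Gen_g ^ n - 1, gen Gen_x ^ n,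
        gen Gen_x * gen Gen_g - const lam * gen Gen_g * gen Gen_x} \<and>
     tensor_square H \<and>
     algebra_hom (hscale H) (tscale H) (comult H) \<and>
     algebra_hom (hscale H) (*) (counit H) \<and>
     algebra_antihom (hscale H) (hscale H) (antipode H) \<and>
     comult H g = tensor H g g \<and> comult H x = tensor H g x + tensor H x 1 \<and>
     counit H g = 1 \<and> counit H x = 0 \<and>
     antipode H g = g ^ (n - 1) \<and> antipode H x = - (g ^ (n - 1) * x)"

text \<open>
  \<open>p\<close> is a Sweedler expansion of \<open>h\<close>, i.e. \<open>\<Delta>(h) = \<Sum> c\<^sub>i h\<^sub>i \<otimes> h\<^sub>i'\<close> where \<open>p\<close> is
  the formal combination of the pairs \<open>(h\<^sub>i, h\<^sub>i')\<close> with coefficients \<open>c\<^sub>i\<close>.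
\<close>

definition sweedler :: "('k::field, 'h, 't::ring_1) hopf \<Rightarrow> 'h \<Rightarrow> ('h \<times> 'h \<Rightarrow>\<^sub>0 'k) \<Rightarrow> bool" where
  "sweedler H h p \<longleftrightarrow> lin_ext (tscale H) (\<lambda>(a, b). tensor H a b) p = comult H h"

definition hopf_ideal :: "('k::field, 'h::ring_1, 't::ring_1) hopf \<Rightarrow> 'h set \<Rightarrow> bool" where
  "hopf_ideal H I \<longleftrightarrow>
     two_sided_ideal I \<and>
     (\<forall>h\<in>I. comult H h \<in> module.span (tscale H) {tensor H a b | a b. a \<in> I \<or> b \<in> I}) \<and>
     (\<forall>h\<in>I. counit H h = 0) \<and>
     (\<forall>h\<in>I. antipode H h \<in> I)"


section \<open>Actions, invariants and smash products\<close>

definition hopf_action ::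
  "('k::field, 'h::ring_1, 't::ring_1) hopf \<Rightarrow> ('k \<Rightarrow> 'a::ring_1 \<Rightarrow> 'a) \<Rightarrow> ('h \<Rightarrow> 'a \<Rightarrow> 'a) \<Rightarrow> bool"
where
  "hopf_action H s act \<longleftrightarrow>
     (\<forall>r. Vector_Spaces.linear (hscale H) s (\<lambda>h. act h r)) \<and>
     (\<forall>h. Vector_Spaces.linear s s (act h)) \<and>
     (\<forall>r. act 1 r = r) \<and>
     (\<forall>h h' r. act (h * h') r = act h (act h' r)) \<and>
     (\<forall>h. act h 1 = s (counit H h) 1) \<and>
     (\<forall>h p r r'. sweedler H h p \<longrightarrow>
        act h (r * r') = lin_ext s (\<lambda>(h1, h2). act h1 r * act h2 r') p)"

definition inner_faithful ::
  "('k::field, 'h::ring_1, 't::ring_1) hopf \<Rightarrow> ('h \<Rightarrow> 'a::ring_1 \<Rightarrow> 'a) \<Rightarrow> bool" where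
  "inner_faithful H act \<longleftrightarrow>
     \<not> (\<exists>I. hopf_ideal H I \<and> I \<noteq> {0} \<and> (\<forall>h\<in>I. \<forall>r. act h r = 0))"

definition linear_action ::
  "('k::field \<Rightarrow> 'a::ring_1 \<Rightarrow> 'a) \<Rightarrow> 'a \<Rightarrow> 'a \<Rightarrow> 'h \<Rightarrow> 'h \<Rightarrow> ('h \<Rightarrow> 'a \<Rightarrow> 'a) \<Rightarrow> bool" where
  "linear_action s u v g x act \<longleftrightarrow>
     {act g u, act g v, act x u, act x v} \<subseteq> module.span s {u, v}"

definition invariants ::
  "('k::field, 'h::ring_1, 't::ring_1) hopf \<Rightarrow> ('k \<Rightarrow> 'a::ring_1 \<Rightarrow> 'a) \<Rightarrow> ('h \<Rightarrow> 'a \<Rightarrow> 'a) \<Rightarrow> 'a set"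
where
  "invariants H s act = {r. \<forall>h. act h r = s (counit H h) r}"

text \<open>
  The algebra \<^typ>\<open>'b\<close> is the smash product, with \<open>sm r h\<close> in the role of \<open>r # h\<close>.
\<close>

definition smash_product ::
  "('k::field, 'h::ring_1, 't::ring_1) hopf \<Rightarrow> ('k \<Rightarrow> 'a::ring_1 \<Rightarrow> 'a) \<Rightarrow> ('h \<Rightarrow> 'a \<Rightarrow> 'a)
     \<Rightarrow> ('k \<Rightarrow> 'b::ring_1 \<Rightarrow> 'b) \<Rightarrow> ('a \<Rightarrow> 'h \<Rightarrow> 'b) \<Rightarrow> bool" where
  "smash_product H s act sB sm \<longleftrightarrow>
     k_algebra sB \<and> is_tensor_product s (hscale H) sB sm \<and> sm 1 1 = 1 \<and>
     (\<forall>r h r' h' p. sweedler H h p \<longrightarrow>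
        sm r h * sm r' h' = lin_ext sB (\<lambda>(h1, h2). sm (r * act h1 r') (h2 * h')) p)"


text \<open>The fixed ring \<open>A\<^sup>H\<close> inside the smash product, as \<open>A\<^sup>H # 1\<close>.\<close>

definition smash_invariants ::
  "('k::field, 'h::ring_1, 't::ring_1) hopf \<Rightarrow> ('k \<Rightarrow> 'a::ring_1 \<Rightarrow> 'a) \<Rightarrow> ('h \<Rightarrow> 'a \<Rightarrow> 'a)
     \<Rightarrow> ('a \<Rightarrow> 'h \<Rightarrow> 'b) \<Rightarrow> 'b set" where
  "smash_invariants H s act sm = (\<lambda>r. sm r 1) ` invariants H s act"


section \<open>The discriminant of a finite free extension\<close>

definition central_subalgebra ::
  "('k::field \<Rightarrow> 'b::ring_1 \<Rightarrow> 'b) \<Rightarrow> 'b set \<Rightarrow> bool" where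
  "central_subalgebra s C \<longleftrightarrow>
     module.subspace s C \<and> 1 \<in> C \<and> (\<forall>a\<in>C. \<forall>b\<in>C. a * b \<in> C) \<and> (\<forall>c\<in>C. \<forall>b. c * b = b * c)"

definition coordinates_of ::
  "'b::ring_1 set \<Rightarrow> nat \<Rightarrow> (nat \<Rightarrow> 'b) \<Rightarrow> 'b \<Rightarrow> (nat \<Rightarrow> 'b) \<Rightarrow> bool" where
  "coordinates_of C \<omega> z y c \<longleftrightarrow>
     (\<forall>i<\<omega>. c i \<in> C) \<and> (\<forall>i\<ge>\<omega>. c i = 0) \<and> y = (\<Sum>i<\<omega>. c i * z i)"

text \<open>\<open>z 0, \<dots>, z (\<omega> - 1)\<close> is a basis of the whole ring \<^typ>\<open>'b\<close> over \<open>C\<close>.\<close>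

definition is_free_basis :: "'b::ring_1 set \<Rightarrow> nat \<Rightarrow> (nat \<Rightarrow> 'b) \<Rightarrow> bool" where
  "is_free_basis C \<omega> z \<longleftrightarrow> (\<forall>y. \<exists>!c. coordinates_of C \<omega> z y c)"

definition coord :: "'b::ring_1 set \<Rightarrow> nat \<Rightarrow> (nat \<Rightarrow> 'b) \<Rightarrow> 'b \<Rightarrow> nat \<Rightarrow> 'b" where
  "coord C \<omega> z y = (THE c. coordinates_of C \<omega> z y c)"

definition regular_trace :: "'b::ring_1 set \<Rightarrow> nat \<Rightarrow> (nat \<Rightarrow> 'b) \<Rightarrow> 'b \<Rightarrow> 'b" where
  "regular_trace C \<omega> z b = (\<Sum>j<\<omega>. coord C \<omega> z (b * z j) j)"

text \<open>
  The library determinants require a commutative entry type. The entries here lie in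
  the central subset \<open>C\<close> of a noncommutative ring, so the Leibniz formula is written
  out; the order of the factors in \<^const>\<open>prod_list\<close> is immaterial for such entries.
\<close>

definition leibniz_det :: "nat \<Rightarrow> (nat \<Rightarrow> nat \<Rightarrow> 'b::ring_1) \<Rightarrow> 'b" where
  "leibniz_det \<omega> M =
     (\<Sum>\<sigma> | \<sigma> permutes {..<\<omega>}. of_int (sign \<sigma>) * prod_list (map (\<lambda>i. M i (\<sigma> i)) [0..<\<omega>]))"

definition discriminant :: "'b::ring_1 set \<Rightarrow> nat \<Rightarrow> (nat \<Rightarrow> 'b) \<Rightarrow> 'b" where
  "discriminant C \<omega> z = leibniz_det \<omega> (\<lambda>i j. regular_trace C \<omega> z (z i * z j))"

definition eq_up_to_scalar ::
  "('k::field \<Rightarrow> 'b::ring_1 \<Rightarrow> 'b) \<Rightarrow> 'b \<Rightarrow> 'b \<Rightarrow> bool" where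
  "eq_up_to_scalar s a b \<longleftrightarrow> (\<exists>c. c \<noteq> 0 \<and> a = s c b)"

definition has_mult_order :: "'k::field \<Rightarrow> nat \<Rightarrow> bool" where
  "has_mult_order a n \<longleftrightarrow> n > 0 \<and> a ^ n = 1 \<and> (\<forall>m. 0 < m \<and> m < n \<longrightarrow> a ^ m \<noteq> 1)"

end

theory Submission
  imports Defs "Jordan_Normal_Form.Determinant"
begin

hide_const (open) Module.smult

text \<open>
  The center of \<open>A\<close> contains \<open>u\<^sup>n\<close> and \<open>v\<^sup>n\<close>, the fixed ring \<open>A\<^sup>H\<close> is the polynomial ring
  \<open>R = k[u\<^sup>n, v\<^sup>n]\<close>, and \<open>A\<close> is free over \<open>R\<close> on the \<open>u\<^sup>a v\<^sup>b\<close> with \<open>a, b < n\<close>. Since \<open>A # H\<close> acts on \<open>A\<close>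
  by \<open>R\<close>-linear maps, there is a representation \<open>\<Psi> : A # H \<rightarrow> M\<^sub>N(R)\<close> with \<open>N = n\<^sup>2\<close>, and both sides
  have rank \<open>N\<^sup>2\<close>. If \<open>P\<close> is the square matrix of \<open>\<Psi>\<close> and \<open>det P \<noteq> 0\<close>, the regular trace is
  \<open>N tr \<circ> \<Psi>\<close>, so that the discriminant equals \<open>(det P)\<^sup>2\<close> up to a scalar.

  To compute \<open>det P\<close>, write \<open>E\<^sub>c\<close> for the projection of \<open>k[g]\<close> onto the \<open>\<mu>\<^sup>c\<close>-eigenspace of \<open>g\<close> and use
  the basis \<open>E\<^bsub>a+b\<^esub> x\<^sup>b\<close> of \<open>H\<close>. Because \<open>x\<close> lowers the degree in \<open>v\<close>, this element annihilates every
  \<open>u\<^bsup>a'\<^esup> v\<^bsup>b'\<^esup>\<close> with \<open>b' < b\<close>, or with \<open>b' = b\<close> and \<open>a' \<noteq> a\<close>, and it sends \<open>u\<^sup>a v\<^sup>b\<close> to a nonzero multiple of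
  \<open>u\<^bsup>a+b\<^esup>\<close>. Hence \<open>P\<close> is block triangular, its diagonal blocks being right multiplications by scalar
  multiples of \<open>u\<^bsup>a+b\<^esup>\<close>, and \<open>det P\<close> is a scalar times \<open>(det \<rho>(u))\<close> to the power \<open>n\<^sup>2(n - 1)\<close>, where
  \<open>det (\<rho>(u))\<^sup>n = det \<rho>(u\<^sup>n) = (u\<^sup>n)\<^sup>N\<close>.
\<close>

section \<open>Block matrices and discriminants of matrix representations\<close>

lemma mult_add_less_mult:
  fixes l :: nat
  assumes "l < m" "k < N"
  shows "l * N + k < m * N"
proof -
  have "l * N + k < Suc l * N" using assms(2) by simp
  also have "\<dots> \<le> m * N" using assms(1) by (intro mult_le_mono1) simp
  finally show ?thesis .
qed

text \<open>A pair (l, k) with k < N is coded as l * N + k. Every double index below, for matrix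
  entries, monomials and bases, is read off by \<open>div\<close> and \<open>mod\<close> in this
  way.\<close>

lemma sum_div_mod:
  fixes f :: "nat \<Rightarrow> nat \<Rightarrow> 'a::comm_monoid_add"
  shows "(\<Sum>i<m * N. f (i div N) (i mod N)) = (\<Sum>l<m. \<Sum>k<N. f l k)"
proof (cases "N = 0")
  case False
  have "(\<Sum>i<m * N. f (i div N) (i mod N)) = (\<Sum>(l, k)\<in>{..<m} \<times> {..<N}. f l k)"
    using False
    by (intro sum.reindex_bij_witness[of _ "\<lambda>(l, k). l * N + k" "\<lambda>i. (i div N, i mod N)"])
       (auto simp: less_mult_imp_div_less mult_add_less_mult)
  then show ?thesis by (simp add: sum.cartesian_product)
qed simp

text \<open>Induction on \<open>m\<close>: splitting off the last row and column of blocks leaves a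
  zero upper right corner, so the determinant of the last diagonal block factors off.\<close>

lemma det_block_triangular:
  fixes W :: "nat \<Rightarrow> nat \<Rightarrow> 'r::idom mat"
  assumes car: "\<And>l l'. W l l' \<in> carrier_mat N N"
    and zero: "\<And>l l'. l < l' \<Longrightarrow> l' < m \<Longrightarrow> W l l' = 0\<^sub>m N N"
  shows "det (mat (m * N) (m * N)
           (\<lambda>(i, j). W (i div N) (j div N) $$ (i mod N, j mod N))) = (\<Prod>l<m. det (W l l))"
  using zero
proof (induction m)
  case 0
  then show ?case by simp
next
  case (Suc m)
  show ?case
  proof (cases "N = 0")
    \<comment> \<open>Division by 0 tells no blocks apart, but then all matrices are empty and have
      determinant 1.\<close>
    case True
    then show ?thesis using car by (simp add: det_dim_zero)
  next
    case False
    let ?M = "\<lambda>m. mat (m * N) (m * N)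
                (\<lambda>(i, j). W (i div N) (j div N) $$ (i mod N, j mod N))"
    let ?C = "mat N (m * N) (\<lambda>(i, j). W m (j div N) $$ (i, j mod N))"
    have lt: "i div N < m \<longleftrightarrow> i < m * N" for i
      using False by (simp add: div_less_iff_less_mult)
    have eq: "i div N = m" "i mod N = i - m * N" if "\<not> i < m * N" "i < N + m * N" for i
    proof -
      show "i div N = m"
        using that False by (intro div_nat_eqI) (auto simp: algebra_simps)
      then show "i mod N = i - m * N"
        using minus_div_mult_eq_mod[of i N] by simp
    qed
    have "?M (Suc m) = four_block_mat (?M m) (0\<^sub>m (m * N) N) ?C (W m m)"
    proof (rule eq_matI)
      fix i j
      assume "i < dim_row (four_block_mat (?M m) (0\<^sub>m (m * N) N) ?C (W m m))"
        and "j < dim_col (four_block_mat (?M m) (0\<^sub>m (m * N) N) ?C (W m m))"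
      then have ij: "i < N + m * N" "j < N + m * N" using car[of m m] by auto
      show "?M (Suc m) $$ (i, j)
              = four_block_mat (?M m) (0\<^sub>m (m * N) N) ?C (W m m) $$ (i, j)"
      proof (cases "i < m * N \<and> \<not> j < m * N")
        case True
        have "W (i div N) m = 0\<^sub>m N N"
          using True by (intro Suc.prems) (auto simp: lt)
        moreover have "i mod N < N" "j - m * N < N" using True ij False by auto
        ultimately show ?thesis using True ij car[of m m] by (simp add: eq)
      next
        case nc: False
        then show ?thesis
          using ij car[of m m] False by (cases "i < m * N"; cases "j < m * N") (auto simp: eq)
      qed
    qed (use car[of m m] in auto)
    then have "det (?M (Suc m)) = det (?M m) * det (W m m)"
      by (simp only:) (rule det_four_block_mat_upper_right_zero[of _ "m * N" _ N],
          use car in auto)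
    also have "det (?M m) = (\<Prod>l<m. det (W l l))"
      by (rule Suc.IH) (simp add: Suc.prems)
    finally show ?thesis by simp
  qed
qed

text \<open>Were \<open>m < n\<close>, padding both factors with zeros to square matrices would
  leave the product 1, although the padded right factor has a zero row. Used in both directions,
  this shows that two bases over a domain have the same length.\<close>

lemma left_inverse_dim_le:
  fixes A B :: "'r::idom mat"
  assumes A: "A \<in> carrier_mat n m" and B: "B \<in> carrier_mat m n" and AB: "A * B = 1\<^sub>m n"
  shows "n \<le> m"
proof (rule ccontr)
  assume "\<not> n \<le> m"
  then have mn: "m < n" by simp
  define A' where "A' = mat n n (\<lambda>(i, j). if j < m then A $$ (i, j) else 0)"
  define B' where "B' = mat n n (\<lambda>(i, j). if i < m then B $$ (i, j) else 0)"
  have car: "A' \<in> carrier_mat n n" "B' \<in> carrier_mat n n" by (auto simp: A'_def B'_def)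
  have "A' * B' = 1\<^sub>m n"
  proof (rule eq_matI)
    fix i j assume "i < dim_row (1\<^sub>m n :: 'r mat)" "j < dim_col (1\<^sub>m n :: 'r mat)"
    then have ij: "i < n" "j < n" by auto
    have "(A' * B') $$ (i, j) = (\<Sum>k\<in>{0..<n}. A' $$ (i, k) * B' $$ (k, j))"
      using car ij by (simp add: scalar_prod_def)
    also have "\<dots> = (\<Sum>k\<in>{0..<m}. A' $$ (i, k) * B' $$ (k, j))"
      using mn ij by (intro sum.mono_neutral_right) (auto simp: A'_def)
    also have "\<dots> = (\<Sum>k\<in>{0..<m}. A $$ (i, k) * B $$ (k, j))"
      using mn ij by (intro sum.cong) (auto simp: A'_def B'_def)
    also have "\<dots> = (A * B) $$ (i, j)"
      using A B ij by (simp add: scalar_prod_def)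
    finally show "(A' * B') $$ (i, j) = 1\<^sub>m n $$ (i, j)" by (simp add: AB)
  qed (use car in auto)
  then have "det A' * det B' = 1"
    using det_mult[OF car] by simp
  moreover have "det B' = 0"
  proof -
    have "B' = mat\<^sub>r n n (\<lambda>i. if i = m then 0\<^sub>v n else row B' i)"
      by (rule eq_matI) (use mn in \<open>auto simp: B'_def\<close>)
    moreover have "det (mat\<^sub>r n n (\<lambda>i. if i = m then 0\<^sub>v n else row B' i)) = 0"
      by (rule det_row_0[OF mn]) (use car in auto)
    ultimately show ?thesis by simp
  qed
  ultimately show False by simp
qed

definition mat_tr :: "'r::comm_ring_1 mat \<Rightarrow> 'r" where
  "mat_tr A = (\<Sum>i<dim_row A. A $$ (i, i))"

lemma mat_tr_mult:
  assumes "A \<in> carrier_mat n m" "B \<in> carrier_mat m n"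
  shows "mat_tr (A * B) = (\<Sum>i<n. \<Sum>k<m. A $$ (i, k) * B $$ (k, i))"
  using assms by (simp add: mat_tr_def scalar_prod_def atLeast0LessThan)

lemma mat_tr_comm:
  assumes "A \<in> carrier_mat n m" "B \<in> carrier_mat m n"
  shows "mat_tr (A * B) = mat_tr (B * A)"
  unfolding mat_tr_mult[OF assms] mat_tr_mult[OF assms(2,1)]
  by (subst sum.swap) (simp add: mult.commute)

lemma mat_tr_smult: "A \<in> carrier_mat n n \<Longrightarrow> mat_tr (c \<cdot>\<^sub>m A) = c * mat_tr A"
  by (simp add: mat_tr_def sum_distrib_left)

section \<open>Discriminants of algebras with a square matrix representation\<close>

locale matrix_representation =
  fixes j :: "'r::idom \<Rightarrow> 'b::ring_1" and \<Psi> :: "'b \<Rightarrow> 'r mat" and N :: nat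
  assumes j_one: "j 1 = 1" and j_add: "j (p + q) = j p + j q" and j_mult: "j (p * q) = j p * j q"
    and j_inj: "inj j"
    and \<Psi>_carrier: "\<Psi> b \<in> carrier_mat N N"
    and \<Psi>_add: "\<Psi> (b + b') = \<Psi> b + \<Psi> b'"
    and \<Psi>_mult: "\<Psi> (b * b') = \<Psi> b * \<Psi> b'"
    and \<Psi>_scalar: "\<Psi> (j p * b) = p \<cdot>\<^sub>m \<Psi> b"
    and N_nonzero: "(of_nat N :: 'r) \<noteq> 0"
begin

lemma N_pos: "N > 0"
  using N_nonzero by (cases N) auto

lemma j_zero: "j 0 = 0"
  using j_add[of 0 0] by simp

lemma j_sum: "j (sum f S) = (\<Sum>i\<in>S. j (f i))"
  by (induction S rule: infinite_finite_induct) (simp_all add: j_zero j_add)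

lemma j_minus: "j (- p) = - j p"
  using j_add[of p "- p"] by (simp add: j_zero eq_neg_iff_add_eq_0 add.commute)

lemma j_eq_iff: "j p = j q \<longleftrightarrow> p = q"
  using j_inj by (auto dest: injD)

text \<open>Coefficients are taken in the domain \<open>'r\<close> and not in the subset
  \<open>range j\<close>, so that matrices and determinants over a commutative ring apply.\<close>

definition spanning :: "nat \<Rightarrow> (nat \<Rightarrow> 'b) \<Rightarrow> bool" where
  "spanning \<omega> z \<longleftrightarrow> (\<forall>b. \<exists>c. b = (\<Sum>t<\<omega>. j (c t) * z t))"

definition independent :: "nat \<Rightarrow> (nat \<Rightarrow> 'b) \<Rightarrow> bool" where
  "independent \<omega> z \<longleftrightarrow> (\<forall>c. (\<Sum>t<\<omega>. j (c t) * z t) = 0 \<longrightarrow> (\<forall>t<\<omega>. c t = 0))"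

lemma independentD:
  assumes "independent \<omega> z" "(\<Sum>t<\<omega>. j (c t) * z t) = (\<Sum>t<\<omega>. j (d t) * z t)" "t < \<omega>"
  shows "c t = d t"
proof -
  have "(\<Sum>t<\<omega>. j (c t + - d t) * z t) = 0"
    using assms(2) by (simp only: j_add j_minus) (simp add: algebra_simps sum_subtractf)
  then have "c t + - d t = 0"
    using assms(1,3) unfolding independent_def by fast
  then show ?thesis by simp
qed

text \<open>Coordinate functions must be 0 from \<open>\<omega>\<close> on, since otherwise they
  could not be unique; hence the default value.\<close>

lemma coordinates_of_extend:
  "coordinates_of (range j) \<omega> z (\<Sum>t<\<omega>. j (c t) * z t) (\<lambda>t. if t < \<omega> then j (c t) else 0)"
  unfolding coordinates_of_def by (auto intro: sum.cong)

lemma coordinates_of_obtain: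
  assumes "coordinates_of (range j) \<omega> z b c"
  obtains d where "b = (\<Sum>t<\<omega>. j (d t) * z t)" "c = (\<lambda>t. if t < \<omega> then j (d t) else 0)"
proof
  have c: "c t = j (inv_into UNIV j (c t))" if "t < \<omega>" for t
    using assms that by (simp add: coordinates_of_def f_inv_into_f)
  show "b = (\<Sum>t<\<omega>. j (inv_into UNIV j (c t)) * z t)"
    using assms c by (auto simp: coordinates_of_def intro!: sum.cong)
  show "c = (\<lambda>t. if t < \<omega> then j (inv_into UNIV j (c t)) else 0)"
    using assms c by (auto simp: coordinates_of_def fun_eq_iff)
qed

lemma is_free_basis_iff:
  "is_free_basis (range j) \<omega> z \<longleftrightarrow> spanning \<omega> z \<and> independent \<omega> z"
proof safe
  assume fb: "is_free_basis (range j) \<omega> z"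
  show "spanning \<omega> z"
    unfolding spanning_def
  proof
    fix b
    obtain c where "coordinates_of (range j) \<omega> z b c"
      using fb unfolding is_free_basis_def by blast
    then obtain d where "b = (\<Sum>t<\<omega>. j (d t) * z t)"
      by (rule coordinates_of_obtain)
    then show "\<exists>c. b = (\<Sum>t<\<omega>. j (c t) * z t)" by blast
  qed
  show "independent \<omega> z"
    unfolding independent_def
  proof (intro allI impI)
    fix c t assume "(\<Sum>t<\<omega>. j (c t) * z t) = 0" and t: "t < \<omega>"
    then have "coordinates_of (range j) \<omega> z 0 (\<lambda>t. if t < \<omega> then j (c t) else 0)"
      using coordinates_of_extend[of \<omega> z c] by simp
    moreover have "coordinates_of (range j) \<omega> z 0 (\<lambda>t. if t < \<omega> then j 0 else 0)"
      using coordinates_of_extend[of \<omega> z "\<lambda>_. 0"] by (simp add: j_zero)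
    ultimately have "(\<lambda>t. if t < \<omega> then j (c t) else 0) = (\<lambda>t. if t < \<omega> then j 0 else 0)"
      using fb unfolding is_free_basis_def by blast
    from fun_cong[OF this, of t] show "c t = 0"
      using t j_eq_iff[of "c t" 0] by simp
  qed
next
  assume sp: "spanning \<omega> z" and ind: "independent \<omega> z"
  show "is_free_basis (range j) \<omega> z"
    unfolding is_free_basis_def
  proof
    fix b
    obtain c where c: "b = (\<Sum>t<\<omega>. j (c t) * z t)"
      using sp unfolding spanning_def by blast
    show "\<exists>!c. coordinates_of (range j) \<omega> z b c"
    proof (rule ex1I)
      show "coordinates_of (range j) \<omega> z b (\<lambda>t. if t < \<omega> then j (c t) else 0)"
        unfolding c by (rule coordinates_of_extend)
      fix c' assume "coordinates_of (range j) \<omega> z b c'"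
      then obtain d where "b = (\<Sum>t<\<omega>. j (d t) * z t)"
        "c' = (\<lambda>t. if t < \<omega> then j (d t) else 0)"
        by (rule coordinates_of_obtain)
      then show "c' = (\<lambda>t. if t < \<omega> then j (c t) else 0)"
      proof -
        have "d t = c t" if "t < \<omega>" for t
          by (rule independentD[OF ind _ that]) (simp only: c[symmetric] \<open>b = (\<Sum>t<\<omega>. j (d t) * z t)\<close>[symmetric])
        then show ?thesis
          unfolding \<open>c' = (\<lambda>t. if t < \<omega> then j (d t) else 0)\<close> by (simp add: fun_eq_iff)
      qed
    qed
  qed
qed

section \<open>Flattened matrices and the regular trace\<close>

definition flat :: "'b \<Rightarrow> nat \<Rightarrow> 'r" where
  "flat b i = \<Psi> b $$ (i mod N, i div N)"

text \<open>For \<open>\<omega> = N * N\<close> this is the square matrix P of the overview: column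
  \<open>t\<close> is the flattened image of \<open>z t\<close>.\<close>

definition flat_mat :: "nat \<Rightarrow> (nat \<Rightarrow> 'b) \<Rightarrow> 'r mat" where
  "flat_mat \<omega> z = mat (N * N) \<omega> (\<lambda>(i, t). flat (z t) i)"

lemma flat_mat_carrier: "flat_mat \<omega> z \<in> carrier_mat (N * N) \<omega>"
  by (simp add: flat_mat_def)

lemma index_less: "i < N * N \<Longrightarrow> i mod N < N \<and> i div N < N"
  using N_pos by (simp add: less_mult_imp_div_less)

lemma flat_sum:
  assumes i: "i < N * N"
  shows "flat (\<Sum>t\<in>S. j (c t) * z t) i = (\<Sum>t\<in>S. c t * flat (z t) i)"
proof -
  have zero: "flat 0 i = 0"
    using arg_cong[OF \<Psi>_scalar[of 0 0], of "\<lambda>M. M $$ (i mod N, i div N)"]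
      index_less[OF i] \<Psi>_carrier[of 0]
    by (simp add: flat_def)
  show ?thesis
  proof (induction S rule: infinite_finite_induct)
    case (insert x F)
    have "flat (a + b) i = flat a i + flat b i" for a b
      using index_less[OF i] \<Psi>_carrier[of a] \<Psi>_carrier[of b] by (simp add: flat_def \<Psi>_add)
    moreover have "flat (j p * b) i = p * flat b i" for p b
      using index_less[OF i] \<Psi>_carrier[of b] by (simp add: flat_def \<Psi>_scalar)
    ultimately show ?case using insert by simp
  next
    case empty
    show ?case by (simp add: zero)
  next
    case (infinite A)
    then show ?case by (simp add: zero)
  qed
qed

lemma flat_mat_change:
  assumes "\<And>t. t < \<omega>' \<Longrightarrow> z' t = (\<Sum>s<\<omega>. j (T s t) * z s)"
  shows "flat_mat \<omega>' z' = flat_mat \<omega> z * mat \<omega> \<omega>' (\<lambda>(s, t). T s t)"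
  by (rule eq_matI)
     (simp_all add: flat_mat_def assms flat_sum scalar_prod_def atLeast0LessThan mult.commute)

text \<open>The coefficients form a vector in the kernel of P, which is trivial over a domain when
  det P is nonzero. Only the image under \<open>\<Psi>\<close> has to vanish, so the lemma yields
  both independence and faithfulness.\<close>

lemma coefficient_zero_if_flat_zero:
  assumes det: "det (flat_mat (N * N) y) \<noteq> 0"
    and flat: "\<And>i. i < N * N \<Longrightarrow> flat (\<Sum>t<N * N. j (c t) * y t) i = 0" and t: "t < N * N"
  shows "c t = 0"
proof -
  let ?P = "flat_mat (N * N) y" and ?v = "vec (N * N) c"
  have "?P *\<^sub>v ?v = 0\<^sub>v (N * N)"
  proof (rule eq_vecI)
    fix i assume "i < dim_vec (0\<^sub>v (N * N) :: 'r vec)"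
    then have i: "i < N * N" by simp
    have "(?P *\<^sub>v ?v) $ i = flat (\<Sum>t<N * N. j (c t) * y t) i"
      using i by (simp add: flat_mat_def flat_sum scalar_prod_def atLeast0LessThan mult.commute)
    then show "(?P *\<^sub>v ?v) $ i = 0\<^sub>v (N * N) $ i" using i flat by simp
  qed (simp add: flat_mat_def)
  then have "?v = 0\<^sub>v (N * N)"
    using det_0_iff_vec_prod_zero[OF flat_mat_carrier, of y] det vec_carrier[of "N * N" c] by blast
  then have "?v $ t = 0\<^sub>v (N * N) $ t" by simp
  then show "c t = 0" using t by simp
qed

lemma flat_zero: "i < N * N \<Longrightarrow> flat 0 i = 0"
  using flat_sum[of i "\<lambda>_. 0" "\<lambda>_. 0" "{}"] by simp

lemma independent_if_det_nonzero:
  assumes "det (flat_mat (N * N) y) \<noteq> 0"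
  shows "independent (N * N) y"
  unfolding independent_def
proof (intro allI impI)
  fix c t assume 0: "(\<Sum>t<N * N. j (c t) * y t) = 0" and t: "t < N * N"
  show "c t = 0"
    by (rule coefficient_zero_if_flat_zero[OF assms _ t]) (simp add: 0 flat_zero)
qed

definition diag_rep :: "'b \<Rightarrow> 'r mat" where
  "diag_rep b = mat (N * N) (N * N)
     (\<lambda>(i, i'). if i div N = i' div N then \<Psi> b $$ (i mod N, i' mod N) else 0)"

lemma mat_tr_diag_rep: "mat_tr (diag_rep b) = of_nat N * mat_tr (\<Psi> b)"
proof -
  have "mat_tr (diag_rep b) = (\<Sum>i<N * N. \<Psi> b $$ (i mod N, i mod N))"
    by (simp add: mat_tr_def diag_rep_def)
  also have "\<dots> = (\<Sum>l<N. \<Sum>k<N. \<Psi> b $$ (k, k))"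
    by (rule sum_div_mod)
  finally show ?thesis using \<Psi>_carrier[of b] by (simp add: mat_tr_def)
qed

text \<open>\<open>flat\<close> stacks the columns of a matrix, and each column of a product is
  \<open>\<Psi> b\<close> times the same column of \<open>\<Psi> b'\<close>; hence the block
  diagonal \<open>diag_rep b\<close>.\<close>

lemma flat_mult:
  assumes i: "i < N * N"
  shows "flat (b * b') i = (\<Sum>i'<N * N. diag_rep b $$ (i, i') * flat b' i')"
proof -
  note il = index_less[OF i]
  have "(\<Sum>i'<N * N. diag_rep b $$ (i, i') * flat b' i')
        = (\<Sum>i'<N * N. (if i div N = i' div N then \<Psi> b $$ (i mod N, i' mod N) else 0)
             * \<Psi> b' $$ (i' mod N, i' div N))"
    using i by (intro sum.cong) (simp_all add: diag_rep_def flat_def)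
  also have "\<dots> = (\<Sum>l<N. \<Sum>k<N. (if i div N = l then \<Psi> b $$ (i mod N, k) else 0) * \<Psi> b' $$ (k, l))"
    by (rule sum_div_mod)
  also have "\<dots> = (\<Sum>l<N. if i div N = l
                then (\<Sum>k<N. \<Psi> b $$ (i mod N, k) * \<Psi> b' $$ (k, l)) else 0)"
    by (intro sum.cong) auto
  also have "\<dots> = (\<Sum>k<N. \<Psi> b $$ (i mod N, k) * \<Psi> b' $$ (k, i div N))"
    using il by simp
  also have "\<dots> = flat (b * b') i"
    using il \<Psi>_carrier[of b] \<Psi>_carrier[of b']
    by (simp add: flat_def \<Psi>_mult scalar_prod_def atLeast0LessThan)
  finally show ?thesis by simp
qed

text \<open>Left multiplication by \<open>b\<close> corresponds on \<open>N \<times> N\<close> matrices to \<open>N\<close> copies of \<open>\<Psi> b\<close>,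
  one for each column.\<close>

lemma regular_trace_eq:
  assumes fb: "is_free_basis (range j) (N * N) z"
    and det: "det (flat_mat (N * N) z) \<noteq> 0"
  shows "regular_trace (range j) (N * N) z b = j (of_nat N * mat_tr (\<Psi> b))"
proof -
  let ?\<omega> = "N * N" and ?P = "flat_mat (N * N) z"
  have sp: "spanning ?\<omega> z" and ind: "independent ?\<omega> z"
    using fb unfolding is_free_basis_iff by blast+
  obtain \<kappa> where \<kappa>: "\<And>b. b = (\<Sum>t<?\<omega>. j (\<kappa> b t) * z t)"
    using sp unfolding spanning_def by metis
  have coord: "coord (range j) ?\<omega> z b t = j (\<kappa> b t)" if "t < ?\<omega>" for b t
  proof -
    have co: "coordinates_of (range j) ?\<omega> z b (\<lambda>t. if t < ?\<omega> then j (\<kappa> b t) else 0)"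
      using coordinates_of_extend[of ?\<omega> z "\<kappa> b"] by (simp only: \<kappa>[of b, symmetric])
    have ex1: "\<exists>!c. coordinates_of (range j) ?\<omega> z b c"
      using fb unfolding is_free_basis_def by (rule spec)
    have "coord (range j) ?\<omega> z b = (\<lambda>t. if t < ?\<omega> then j (\<kappa> b t) else 0)"
      unfolding coord_def by (rule the1_equality) (rule ex1, rule co)
    then show ?thesis using that by simp
  qed
  define L where "L = mat ?\<omega> ?\<omega> (\<lambda>(s, t). \<kappa> (b * z t) s)"
  have L: "L \<in> carrier_mat ?\<omega> ?\<omega>" by (simp add: L_def)
  have K: "diag_rep b \<in> carrier_mat ?\<omega> ?\<omega>" by (simp add: diag_rep_def)
  have P: "?P \<in> carrier_mat ?\<omega> ?\<omega>" by (rule flat_mat_carrier)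
  have Q: "adj_mat ?P \<in> carrier_mat ?\<omega> ?\<omega>" by (rule adj_mat(1)[OF P])
  \<comment> \<open>Over the fraction field P conjugates \<open>L\<close>, the matrix of left
    multiplication by \<open>b\<close>, into \<open>diag_rep b\<close>.\<close>
  have PL: "?P * L = diag_rep b * ?P"
  proof -
    have "?P * L = flat_mat ?\<omega> (\<lambda>t. b * z t)"
      unfolding L_def by (rule flat_mat_change[symmetric]) (rule \<kappa>)
    also have "\<dots> = diag_rep b * ?P"
      by (rule eq_matI) (use K in \<open>simp_all add: flat_mat_def flat_mult scalar_prod_def
          atLeast0LessThan\<close>)
    finally show ?thesis .
  qed
  \<comment> \<open>P need not be invertible over \<open>'r\<close>, so the adjugate replaces its
    inverse; the factor det P that appears on both sides is cancelled at the end.\<close>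
  have "det ?P * mat_tr L = mat_tr (adj_mat ?P * ?P * L)"
  proof -
    have "adj_mat ?P * ?P * L = det ?P \<cdot>\<^sub>m L"
      unfolding adj_mat(3)[OF P] using L
      by (simp add: mult_smult_assoc_mat[of _ ?\<omega> ?\<omega> _ ?\<omega>])
    then show ?thesis using L by (simp add: mat_tr_smult)
  qed
  also have "adj_mat ?P * ?P * L = adj_mat ?P * (diag_rep b * ?P)"
    using L P Q PL by (simp add: assoc_mult_mat[of _ ?\<omega> ?\<omega> _ ?\<omega> _ ?\<omega>])
  also have "mat_tr \<dots> = mat_tr (diag_rep b * ?P * adj_mat ?P)"
    using K P Q by (intro mat_tr_comm[of _ ?\<omega> ?\<omega>]) auto
  also have "diag_rep b * ?P * adj_mat ?P = det ?P \<cdot>\<^sub>m diag_rep b"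
    using K P Q adj_mat(2)[OF P]
    by (simp add: assoc_mult_mat[of _ ?\<omega> ?\<omega> _ ?\<omega> _ ?\<omega>] mult_smult_distrib[of _ ?\<omega> ?\<omega> _ ?\<omega>])
  also have "mat_tr \<dots> = det ?P * mat_tr (diag_rep b)"
    using K by (rule mat_tr_smult)
  finally have "mat_tr L = of_nat N * mat_tr (\<Psi> b)"
    using det by (simp add: mat_tr_diag_rep)
  moreover have "regular_trace (range j) ?\<omega> z b = j (mat_tr L)"
    unfolding regular_trace_def by (simp add: coord mat_tr_def L_def j_sum)
  ultimately show ?thesis by simp
qed

text \<open>\<open>j\<close> is a ring homomorphism, so it commutes with the sums, signs and
  products of the Leibniz formula.\<close>

lemma leibniz_det_j: "leibniz_det \<omega> (\<lambda>s t. j (G s t)) = j (det (mat \<omega> \<omega> (\<lambda>(s, t). G s t)))"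
proof -
  have pl: "prod_list (map (\<lambda>s. j (f s)) xs) = j (prod_list (map f xs))" for f :: "nat \<Rightarrow> 'r" and xs
    by (induction xs) (simp_all add: j_one j_mult)
  have oi: "of_int i * j p = j (of_int i * p)" for i p
  proof -
    have "j (of_nat m) = of_nat m" for m
      by (induction m) (simp_all add: j_zero j_one j_add)
    then have "j (of_int i) = of_int i"
      by (cases i rule: int_cases2) (simp_all add: j_minus)
    then show ?thesis by (simp add: j_mult)
  qed
  have pr: "prod_list (map f [0..<\<omega>]) = (\<Prod>i = 0..<\<omega>. f i)" for f :: "nat \<Rightarrow> 'r"
    by (induction \<omega>) simp_all
  have "leibniz_det \<omega> (\<lambda>s t. j (G s t))
      = j (\<Sum>\<sigma> | \<sigma> permutes {0..<\<omega>}. of_int (sign \<sigma>) * (\<Prod>i = 0..<\<omega>. G i (\<sigma> i)))"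
    unfolding leibniz_det_def pl oi j_sum pr atLeast0LessThan ..
  also have "(\<Sum>\<sigma> | \<sigma> permutes {0..<\<omega>}. of_int (sign \<sigma>) * (\<Prod>i = 0..<\<omega>. G i (\<sigma> i)))
      = det (mat \<omega> \<omega> (\<lambda>(s, t). G s t))"
  proof -
    have "(\<Prod>i = 0..<\<omega>. G i (\<sigma> i)) = (\<Prod>i = 0..<\<omega>. mat \<omega> \<omega> (\<lambda>(s, t). G s t) $$ (i, \<sigma> i))"
      if "\<sigma> permutes {0..<\<omega>}" for \<sigma>
      using permutes_in_image[OF that] by (intro prod.cong) auto
    then show ?thesis by (simp add: det_def)
  qed
  finally show ?thesis .
qed

section \<open>The trace form and change of basis\<close>

definition transposition_mat :: "'r mat" where
  "transposition_mat = mat (N * N) (N * N)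
     (\<lambda>(i, i'). if i mod N = i' div N \<and> i div N = i' mod N then 1 else 0)"

lemma transposition_mat_sum:
  assumes i: "i < N * N"
  shows "(\<Sum>i'<N * N. transposition_mat $$ (i, i') * f i') = f ((i mod N) * N + i div N)"
proof -
  note il = index_less[OF i]
  have lt: "(i mod N) * N + i div N < N * N"
    using il by (simp add: mult_add_less_mult)
  have "(\<Sum>i'<N * N. transposition_mat $$ (i, i') * f i')
      = (\<Sum>i'<N * N. if i' = (i mod N) * N + i div N then f i' else 0)"
  proof (rule sum.cong)
    fix i' assume i': "i' \<in> {..<N * N}"
    have "(i mod N = i' div N \<and> i div N = i' mod N) \<longleftrightarrow> i' = (i mod N) * N + i div N"
      using il div_mult_mod_eq[of i' N] by (auto simp: mult.commute)
    then show "transposition_mat $$ (i, i') * f i'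
        = (if i' = (i mod N) * N + i div N then f i' else 0)"
      using i i' by (simp add: transposition_mat_def)
  qed simp
  then show ?thesis using lt by simp
qed

text \<open>In flattened coordinates the matrix is the permutation matrix of transposing an N by N
  matrix. Transposition is an involution, so the square is 1.\<close>

lemma transposition_mat_unit: "det transposition_mat dvd 1"
proof -
  have car: "transposition_mat \<in> carrier_mat (N * N) (N * N)"
    by (simp add: transposition_mat_def)
  have "transposition_mat * transposition_mat = 1\<^sub>m (N * N)"
  proof (rule eq_matI)
    fix i i' assume "i < dim_row (1\<^sub>m (N * N) :: 'r mat)" "i' < dim_col (1\<^sub>m (N * N) :: 'r mat)"
    then have i: "i < N * N" "i' < N * N" by auto
    note il = index_less[OF i(1)] index_less[OF i(2)]
    have lt: "(i mod N) * N + i div N < N * N"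
      using il by (simp add: mult_add_less_mult)
    have "(transposition_mat * transposition_mat) $$ (i, i')
       = (\<Sum>k<N * N. transposition_mat $$ (i, k) * transposition_mat $$ (k, i'))"
      using car i by (simp add: scalar_prod_def atLeast0LessThan)
    also have "\<dots> = transposition_mat $$ ((i mod N) * N + i div N, i')"
      by (rule transposition_mat_sum[OF i(1)])
    also have "\<dots> = (if i div N = i' div N \<and> i mod N = i' mod N then 1 else 0)"
      using i il lt by (simp add: transposition_mat_def)
    also have "\<dots> = 1\<^sub>m (N * N) $$ (i, i')"
    proof -
      have "i = i'" if that: "i div N = i' div N" "i mod N = i' mod N"
      proof -
        have "i div N * N + i mod N = i' div N * N + i' mod N" by (simp only: that)
        then show ?thesis by (simp only: div_mult_mod_eq)
      qed
      then show ?thesis using i by auto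
    qed
    finally show "(transposition_mat * transposition_mat) $$ (i, i') = 1\<^sub>m (N * N) $$ (i, i')" .
  qed (use car in auto)
  then have "det transposition_mat * det transposition_mat = 1"
    using det_mult[OF car car] by simp
  then show ?thesis by (metis dvd_triv_left)
qed

text \<open>The trace of XY pairs the entries of X with those of the transpose of Y, so the
  transposition matrix is the Gram matrix of the trace form.\<close>

lemma mat_tr_mult_flat:
  "mat_tr (\<Psi> (b * b')) = (\<Sum>i<N * N. flat b i * (\<Sum>i'<N * N. transposition_mat $$ (i, i') * flat b' i'))"
proof -
  have "(\<Sum>i<N * N. flat b i * (\<Sum>i'<N * N. transposition_mat $$ (i, i') * flat b' i'))
      = (\<Sum>i<N * N. flat b i * flat b' ((i mod N) * N + i div N))"
    by (intro sum.cong) (simp_all add: transposition_mat_sum)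
  also have "\<dots> = (\<Sum>i<N * N. \<Psi> b $$ (i mod N, i div N) * \<Psi> b' $$ (i div N, i mod N))"
  proof (intro sum.cong refl)
    fix i assume "i \<in> {..<N * N}"
    then have il: "i mod N < N" "i div N < N" using index_less[of i] by auto
    then have "(i mod N * N + i div N) mod N = i div N" "(i mod N * N + i div N) div N = i mod N"
      by auto
    then show "flat b i * flat b' (i mod N * N + i div N)
        = \<Psi> b $$ (i mod N, i div N) * \<Psi> b' $$ (i div N, i mod N)"
      by (simp only: flat_def)
  qed
  also have "\<dots> = (\<Sum>l<N. \<Sum>k<N. \<Psi> b $$ (k, l) * \<Psi> b' $$ (l, k))"
    by (rule sum_div_mod)
  also have "\<dots> = (\<Sum>k<N. \<Sum>l<N. \<Psi> b $$ (k, l) * \<Psi> b' $$ (l, k))"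
    by (rule sum.swap)
  also have "\<dots> = mat_tr (\<Psi> (b * b'))"
    by (simp add: \<Psi>_mult mat_tr_mult[OF \<Psi>_carrier \<Psi>_carrier])
  finally show ?thesis by simp
qed

text \<open>Passing from \<open>y\<close> to the arbitrary basis \<open>z\<close> multiplies P on
  the right by an invertible matrix \<open>MT\<close>, and the Gram matrix of \<open>z\<close> is N
  times the product of the transpose of P, the transposition matrix and P. The unit
  \<open>\<epsilon>\<close> collects det \<open>MT\<close> squared and the determinant of the
  transposition matrix.\<close>

theorem discriminant_eq:
  assumes y: "spanning (N * N) y" and det: "det (flat_mat (N * N) y) \<noteq> 0"
    and fb: "is_free_basis (range j) \<omega> z"
  obtains \<epsilon> where "\<epsilon> dvd 1"
    and "discriminant (range j) \<omega> z
           = j (of_nat N ^ (N * N) * \<epsilon> * det (flat_mat (N * N) y) ^ 2)"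
proof -
  let ?n = "N * N"
  have indy: "independent ?n y" using det by (rule independent_if_det_nonzero)
  have spz: "spanning \<omega> z" and indz: "independent \<omega> z"
    using fb unfolding is_free_basis_iff by blast+
  obtain \<kappa> where \<kappa>: "\<And>b. b = (\<Sum>t<\<omega>. j (\<kappa> b t) * z t)"
    using spz unfolding spanning_def by metis
  obtain \<kappa>' where \<kappa>': "\<And>b. b = (\<Sum>t<?n. j (\<kappa>' b t) * y t)"
    using y unfolding spanning_def by metis
  define S where "S s t = \<kappa> (y t) s" for s t
  define T where "T s t = \<kappa>' (z t) s" for s t
  have S: "y t = (\<Sum>s<\<omega>. j (S s t) * z s)" for t
    unfolding S_def by (rule \<kappa>)
  have T: "z t = (\<Sum>s<?n. j (T s t) * y s)" for t
    unfolding T_def by (rule \<kappa>')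
  \<comment> \<open>Substituting one expansion into the other; comparing coefficients then shows
    that the two transition matrices are mutually inverse.\<close>
  have comp: "(\<Sum>s<\<omega>. j (S s t) * z s) = (\<Sum>r<?n. j (\<Sum>s<\<omega>. T r s * S s t) * y r)" for t
  proof -
    have "(\<Sum>s<\<omega>. j (S s t) * z s) = (\<Sum>s<\<omega>. \<Sum>r<?n. j (T r s * S s t) * y r)"
      unfolding T
      by (simp only: sum_distrib_left mult.assoc[symmetric] j_mult[symmetric] mult.commute[of "T _ _"])
    also have "\<dots> = (\<Sum>r<?n. \<Sum>s<\<omega>. j (T r s * S s t) * y r)" by (rule sum.swap)
    finally show ?thesis by (simp add: j_sum sum_distrib_right)
  qed
  have comp': "(\<Sum>s<?n. j (T s t) * y s) = (\<Sum>r<\<omega>. j (\<Sum>s<?n. S r s * T s t) * z r)" for t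
  proof -
    have "(\<Sum>s<?n. j (T s t) * y s) = (\<Sum>s<?n. \<Sum>r<\<omega>. j (S r s * T s t) * z r)"
      unfolding S
      by (simp only: sum_distrib_left mult.assoc[symmetric] j_mult[symmetric] mult.commute[of "S _ _"])
    also have "\<dots> = (\<Sum>r<\<omega>. \<Sum>s<?n. j (S r s * T s t) * z r)" by (rule sum.swap)
    finally show ?thesis by (simp add: j_sum sum_distrib_right)
  qed
  have unit_sum: "(\<Sum>s<m. j (if s = t then 1 else 0) * w s) = w t" if "t < m" for m t and w :: "nat \<Rightarrow> 'b"
  proof -
    have "(\<Sum>s<m. j (if s = t then 1 else 0) * w s) = (\<Sum>s<m. if s = t then w s else 0)"
      by (intro sum.cong) (simp_all add: j_one j_zero)
    then show ?thesis using that by simp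
  qed
  have TS: "(\<Sum>s<\<omega>. T r s * S s t) = (if r = t then 1 else 0)" if "r < ?n" "t < ?n" for r t
    by (rule independentD[OF indy _ that(1)])
       (simp only: comp[symmetric] S[symmetric] unit_sum[OF that(2)])
  have ST: "(\<Sum>s<?n. S r s * T s t) = (if r = t then 1 else 0)" if "r < \<omega>" "t < \<omega>" for r t
    by (rule independentD[OF indz _ that(1)])
       (simp only: comp'[symmetric] T[symmetric] unit_sum[OF that(2)])
  define MS where "MS = mat \<omega> ?n (\<lambda>(s, t). S s t)"
  define MT where "MT = mat ?n \<omega> (\<lambda>(s, t). T s t)"
  have car: "MS \<in> carrier_mat \<omega> ?n" "MT \<in> carrier_mat ?n \<omega>" by (auto simp: MS_def MT_def)
  have 1: "MT * MS = 1\<^sub>m ?n"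
    by (rule eq_matI) (simp_all add: MS_def MT_def scalar_prod_def atLeast0LessThan TS)
  have 2: "MS * MT = 1\<^sub>m \<omega>"
    by (rule eq_matI) (simp_all add: MS_def MT_def scalar_prod_def atLeast0LessThan ST)
  \<comment> \<open>The rank of \<open>z\<close> is not given in advance; the two transition
    matrices force it to be N * N.\<close>
  have \<omega>: "\<omega> = ?n"
    using left_inverse_dim_le[OF car 2] left_inverse_dim_le[OF car(2,1) 1] by simp
  have "det MT * det MS = 1"
    using det_mult[of MT ?n MS] car 1 \<omega> by simp
  then have unit: "det MT dvd 1" by (metis dvd_triv_left)
  let ?P = "flat_mat ?n z"
  have Pz: "?P = flat_mat ?n y * MT"
    unfolding MT_def \<omega> by (rule flat_mat_change) (rule T)
  have detPz: "det ?P = det (flat_mat ?n y) * det MT"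
    unfolding Pz using car \<omega> by (intro det_mult[OF flat_mat_carrier]) auto
  have "det ?P \<noteq> 0" using detPz det unit by auto
  then have tr: "regular_trace (range j) ?n z b = j (of_nat N * mat_tr (\<Psi> b))" for b
    using regular_trace_eq fb \<omega> by simp
  have tc: "transposition_mat \<in> carrier_mat ?n ?n" by (simp add: transposition_mat_def)
  have P: "?P \<in> carrier_mat ?n ?n" by (rule flat_mat_carrier)
  have gram: "mat ?n ?n (\<lambda>(s, t). of_nat N * mat_tr (\<Psi> (z s * z t)))
      = of_nat N \<cdot>\<^sub>m (transpose_mat ?P * (transposition_mat * ?P))"
  proof (rule eq_matI)
    fix s t
    assume "s < dim_row (of_nat N \<cdot>\<^sub>m (transpose_mat ?P * (transposition_mat * ?P)))"
      "t < dim_col (of_nat N \<cdot>\<^sub>m (transpose_mat ?P * (transposition_mat * ?P)))"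
    then have st: "s < ?n" "t < ?n" using P by auto
    have "(transpose_mat ?P * (transposition_mat * ?P)) $$ (s, t)
       = (\<Sum>i<?n. ?P $$ (i, s) * (\<Sum>i'<?n. transposition_mat $$ (i, i') * ?P $$ (i', t)))"
      using st P tc by (simp add: scalar_prod_def atLeast0LessThan)
    also have "\<dots> = mat_tr (\<Psi> (z s * z t))"
      unfolding mat_tr_mult_flat using st by (intro sum.cong) (simp_all add: flat_mat_def)
    finally show "mat ?n ?n (\<lambda>(s, t). of_nat N * mat_tr (\<Psi> (z s * z t))) $$ (s, t)
       = (of_nat N \<cdot>\<^sub>m (transpose_mat ?P * (transposition_mat * ?P))) $$ (s, t)"
      using st P tc by simp
  qed (use P in auto)
  have "discriminant (range j) \<omega> z
      = j (det (mat ?n ?n (\<lambda>(s, t). of_nat N * mat_tr (\<Psi> (z s * z t)))))"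
    unfolding discriminant_def \<omega> tr leibniz_det_j ..
  also have "det (mat ?n ?n (\<lambda>(s, t). of_nat N * mat_tr (\<Psi> (z s * z t))))
      = of_nat N ^ ?n * (det ?P * (det transposition_mat * det ?P))"
    unfolding gram
    using P tc by (simp add: det_mult[of _ ?n] det_transpose[of _ ?n] carrier_matD(2)[OF P])
  also have "\<dots> = of_nat N ^ ?n * (det transposition_mat * (det MT * det MT))
                    * det (flat_mat ?n y) ^ 2"
    by (simp add: detPz power2_eq_square ac_simps)
  finally show ?thesis
    using that[of "det transposition_mat * (det MT * det MT)"] unit transposition_mat_unit
    by (simp add: mult_unit_dvd_iff)
qed

end

section \<open>Presentations and tensor products\<close>

context k_algebra
begin

lemma mult_scale_left: "scale c a * b = scale c (a * b)"
  by (simp add: scale_mult_left)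

lemma mult_scale_right: "a * scale c b = scale c (a * b)"
  by (simp add: scale_mult_right)

lemmas mult_scale = mult_scale_left mult_scale_right

end

text \<open>A formal combination is a finite sum of single terms, each carrying its own coefficient;
  the zero combination arises as \<open>single x 0\<close>.\<close>

lemma poly_mapping_additive_induct [case_names single add]:
  assumes single: "\<And>x c. P (Poly_Mapping.single x c)"
    and add: "\<And>p q. P p \<Longrightarrow> P q \<Longrightarrow> P (p + q)"
  shows "P (p :: 'x \<Rightarrow>\<^sub>0 'k::comm_monoid_add)"
proof (induction p rule: Poly_Mapping.update_induct)
  case const
  have "P (Poly_Mapping.single x 0)" for x by (rule single)
  then show ?case by simp
next
  case (update f a b)
  have "Poly_Mapping.update a b f = f + Poly_Mapping.single a b"
    using update(1) by (intro poly_mapping_eqI)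
      (auto simp: lookup_update lookup_add lookup_single when_def in_keys_iff)
  then show ?case using update add single by simp
qed

context vector_space
begin

lemma lin_ext_superset:
  assumes "finite S" "Poly_Mapping.keys p \<subseteq> S"
  shows "lin_ext scale f p = (\<Sum>x\<in>S. scale (Poly_Mapping.lookup p x) (f x))"
  unfolding lin_ext_def using assms
  by (intro sum.mono_neutral_left) (auto simp: in_keys_iff)

lemma lin_ext_single: "lin_ext scale f (Poly_Mapping.single x c) = scale c (f x)"
  by (simp add: lin_ext_superset[of "{x}"])

lemma lin_ext_zero: "lin_ext scale f 0 = 0"
  by (simp add: lin_ext_def)

lemma lin_ext_add: "lin_ext scale f (p + q) = lin_ext scale f p + lin_ext scale f q"
proof -
  let ?S = "Poly_Mapping.keys p \<union> Poly_Mapping.keys q"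
  have "Poly_Mapping.keys (p + q) \<subseteq> ?S" by (rule keys_add)
  then show ?thesis
    by (simp add: lin_ext_superset[of ?S] lookup_add scale_left_distrib sum.distrib)
qed

lemma lin_ext_uminus: "lin_ext scale f (- p) = - lin_ext scale f p"
  using lin_ext_add[of f p "- p"] by (simp add: lin_ext_zero eq_neg_iff_add_eq_0 add.commute)

lemma lin_ext_diff: "lin_ext scale f (p - q) = lin_ext scale f p - lin_ext scale f q"
  using lin_ext_add[of f p "- q"] by (simp add: lin_ext_uminus)

lemma lin_ext_map: "lin_ext scale f (Poly_Mapping.map ((*) c) p) = scale c (lin_ext scale f p)"
proof -
  have l: "Poly_Mapping.lookup (Poly_Mapping.map ((*) c) p) x = c * Poly_Mapping.lookup p x" for x
    by (simp add: map.rep_eq when_def)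
  then have "Poly_Mapping.keys (Poly_Mapping.map ((*) c) p) \<subseteq> Poly_Mapping.keys p"
    by (auto simp: in_keys_iff)
  then have "lin_ext scale f (Poly_Mapping.map ((*) c) p)
      = (\<Sum>x\<in>Poly_Mapping.keys p. scale (c * Poly_Mapping.lookup p x) (f x))"
    by (simp add: lin_ext_superset[of "Poly_Mapping.keys p"] l)
  then show ?thesis by (simp add: lin_ext_def scale_sum_right)
qed

end

lemma vector_space_poly_mapping:
  "vector_space (\<lambda>(c::'k::field) (p :: 'x \<Rightarrow>\<^sub>0 'k). Poly_Mapping.map ((*) c) p)"
proof -
  have l: "Poly_Mapping.lookup (Poly_Mapping.map ((*) c) p) x = c * Poly_Mapping.lookup p x"
    for c :: 'k and p :: "'x \<Rightarrow>\<^sub>0 'k" and x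
    by (simp add: map.rep_eq when_def)
  show ?thesis
    by unfold_locales (auto intro!: poly_mapping_eqI simp: l lookup_add algebra_simps)
qed

context k_algebra
begin

lemma free_eval_single:
  "free_eval scale \<phi> (Poly_Mapping.single w c) = scale c (prod_list (map \<phi> (letters w)))"
  by (simp add: free_eval_def lin_ext_single)

lemma free_eval_add: "free_eval scale \<phi> (p + q) = free_eval scale \<phi> p + free_eval scale \<phi> q"
  by (simp add: free_eval_def lin_ext_add)

lemma free_eval_diff: "free_eval scale \<phi> (p - q) = free_eval scale \<phi> p - free_eval scale \<phi> q"
  by (simp add: free_eval_def lin_ext_diff)

lemma free_eval_zero: "free_eval scale \<phi> 0 = 0"
  by (simp add: free_eval_def lin_ext_zero)

lemma free_eval_const: "free_eval scale \<phi> (const c) = scale c 1"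
  by (simp add: const_def free_eval_single zero_word_def)

lemma free_eval_one: "free_eval scale \<phi> 1 = 1"
  unfolding single_one[symmetric] by (simp only: free_eval_single zero_word_def) simp

lemma free_eval_gen: "free_eval scale \<phi> (gen i) = \<phi> i"
  by (simp add: gen_def free_eval_single)

lemma free_eval_mult: "free_eval scale \<phi> (p * q) = free_eval scale \<phi> p * free_eval scale \<phi> q"
proof (induction p rule: poly_mapping_additive_induct)
  case (single w c)
  show ?case
    by (induction q rule: poly_mapping_additive_induct)
       (simp_all add: mult_single free_eval_single plus_word_def mult_scale distrib_left
         free_eval_add)
qed (simp add: distrib_right free_eval_add)

lemma free_eval_power: "free_eval scale \<phi> (p ^ m) = free_eval scale \<phi> p ^ m"
  by (induction m) (simp_all add: free_eval_one free_eval_mult)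

lemmas free_eval_simps = free_eval_add free_eval_diff free_eval_zero free_eval_const
  free_eval_one free_eval_gen free_eval_mult free_eval_power

end

section \<open>Presented algebras: induction and universal property\<close>

lemma presented_by_relation:
  assumes "presented_by s \<phi> R" "r \<in> R"
  shows "free_eval s \<phi> r = 0"
  using assms hull_inc[of r R two_sided_ideal] by (auto simp: presented_by_def)

text \<open>Evaluation is onto, so every element is a combination of words in the generators. Words
  grow on the right here and on the left in the companion rule.\<close>

lemma presented_by_induct [consumes 1, case_names one gen add scale]:
  assumes pres: "presented_by s \<phi> R"
    and one: "P 1" and gen: "\<And>a i. P a \<Longrightarrow> P (a * \<phi> i)"
    and add: "\<And>a b. P a \<Longrightarrow> P b \<Longrightarrow> P (a + b)" and scale: "\<And>c a. P a \<Longrightarrow> P (s c a)"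
  shows "P a"
proof -
  interpret k_algebra s using pres by (simp add: presented_by_def)
  have word: "P (prod_list (map \<phi> ws))" for ws
    by (induction ws rule: rev_induct) (simp_all add: one gen)
  obtain p where "a = free_eval s \<phi> p"
    using pres by (auto simp: presented_by_def)
  moreover have "P (free_eval s \<phi> p)"
    by (induction p rule: poly_mapping_additive_induct)
       (auto simp: free_eval_single free_eval_add intro: scale word add)
  ultimately show ?thesis by simp
qed

lemma presented_by_induct_left [consumes 1, case_names one gen add scale]:
  assumes pres: "presented_by s \<phi> R"
    and one: "P 1" and gen: "\<And>a i. P a \<Longrightarrow> P (\<phi> i * a)"
    and add: "\<And>a b. P a \<Longrightarrow> P b \<Longrightarrow> P (a + b)" and scale: "\<And>c a. P a \<Longrightarrow> P (s c a)"
  shows "P a"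
proof -
  interpret k_algebra s using pres by (simp add: presented_by_def)
  have word: "P (prod_list (map \<phi> ws))" for ws
    by (induction ws) (simp_all add: one gen)
  obtain p where "a = free_eval s \<phi> p"
    using pres by (auto simp: presented_by_def)
  moreover have "P (free_eval s \<phi> p)"
    by (induction p rule: poly_mapping_additive_induct)
       (auto simp: free_eval_single free_eval_add intro: scale word add)
  ultimately show ?thesis by simp
qed

text \<open>The kernel of evaluation in the target is a two-sided ideal containing \<open>R\<close>,
  hence contains the ideal generated by \<open>R\<close>, which is the kernel of evaluation in the
  source.\<close>

lemma presented_by_hom:
  assumes pres: "presented_by s \<phi> R" and t: "k_algebra t"
    and rel: "\<And>r. r \<in> R \<Longrightarrow> free_eval t \<phi>' r = 0"
  obtains \<psi> where "\<And>i. \<psi> (\<phi> i) = \<phi>' i" "\<psi> 1 = 1" "\<And>a b. \<psi> (a * b) = \<psi> a * \<psi> b"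
    "\<And>a b. \<psi> (a + b) = \<psi> a + \<psi> b" "\<And>c a. \<psi> (s c a) = t c (\<psi> a)"
proof -
  interpret S: k_algebra s using pres by (simp add: presented_by_def)
  interpret T: k_algebra t by (rule t)
  have "two_sided_ideal {p. free_eval t \<phi>' p = 0}"
    by (auto simp: two_sided_ideal_def T.free_eval_simps)
  then have "two_sided_ideal hull R \<subseteq> {p. free_eval t \<phi>' p = 0}"
    using rel by (intro hull_minimal) auto
  then have ker: "free_eval t \<phi>' p = 0" if "free_eval s \<phi> p = 0" for p
    using that pres by (auto simp: presented_by_def)
  \<comment> \<open>Any preimage serves: two of them differ by an element of the kernel, which the
    target evaluation kills.\<close>
  define \<psi> where "\<psi> a = free_eval t \<phi>' (SOME p. free_eval s \<phi> p = a)" for a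
  have \<psi>: "\<psi> (free_eval s \<phi> p) = free_eval t \<phi>' p" for p
  proof -
    have "free_eval s \<phi> (SOME q. free_eval s \<phi> q = free_eval s \<phi> p) = free_eval s \<phi> p"
      by (rule someI) (rule refl)
    then have "free_eval t \<phi>' ((SOME q. free_eval s \<phi> q = free_eval s \<phi> p) - p) = 0"
      by (intro ker) (simp add: S.free_eval_diff)
    then show ?thesis by (simp add: \<psi>_def T.free_eval_diff)
  qed
  have surj: "\<exists>p. a = free_eval s \<phi> p" for a
    using pres by (auto simp: presented_by_def)
  show ?thesis
  proof
    show "\<psi> (\<phi> i) = \<phi>' i" for i
      using \<psi>[of "gen i"] by (simp add: S.free_eval_gen T.free_eval_gen)
    show "\<psi> 1 = 1"
      using \<psi>[of 1] by (simp add: S.free_eval_one T.free_eval_one)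
    show "\<psi> (a * b) = \<psi> a * \<psi> b" for a b
      using surj[of a] surj[of b] by (metis S.free_eval_mult T.free_eval_mult \<psi>)
    show "\<psi> (a + b) = \<psi> a + \<psi> b" for a b
      using surj[of a] surj[of b] by (metis S.free_eval_add T.free_eval_add \<psi>)
    show "\<psi> (s c a) = t c (\<psi> a)" for c a
    proof -
      obtain p where p: "a = free_eval s \<phi> p" using surj by blast
      then have "s c a = free_eval s \<phi> (const c * p)"
        by (simp add: S.free_eval_simps S.mult_scale)
      then show ?thesis
        using p \<psi> by (simp add: T.free_eval_simps T.mult_scale)
    qed
  qed
qed

section \<open>Bilinearity and universal property of the tensor product\<close>

locale tensor_product =
  fixes s :: "'k::field \<Rightarrow> 'v::ab_group_add \<Rightarrow> 'v" and t :: "'k \<Rightarrow> 'w::ab_group_add \<Rightarrow> 'w"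
    and sT :: "'k \<Rightarrow> 't::ab_group_add \<Rightarrow> 't" and \<tau> :: "'v \<Rightarrow> 'w \<Rightarrow> 't"
  assumes tensor: "is_tensor_product s t sT \<tau>"
begin

sublocale vector_space sT
  using tensor by (simp add: is_tensor_product_def)

abbreviation tensor_eval :: "('v \<times> 'w \<Rightarrow>\<^sub>0 'k) \<Rightarrow> 't" where
  "tensor_eval \<equiv> lin_ext sT (\<lambda>(a, b). \<tau> a b)"

lemma tensor_relation: "p \<in> tensor_relations s t \<Longrightarrow> tensor_eval p = 0"
proof -
  interpret F: vector_space "\<lambda>(c::'k) (p :: 'v \<times> 'w \<Rightarrow>\<^sub>0 'k). Poly_Mapping.map ((*) c) p"
    by (rule vector_space_poly_mapping)
  assume "p \<in> tensor_relations s t"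
  then have "p \<in> F.span (tensor_relations s t)" by (rule F.span_base)
  then show ?thesis using tensor by (auto simp: is_tensor_product_def)
qed

lemma tensor_add_left: "\<tau> (a + a') b = \<tau> a b + \<tau> a' b"
proof -
  have "tensor_eval (Poly_Mapping.single (a + a', b) 1 - Poly_Mapping.single (a, b) 1
        - Poly_Mapping.single (a', b) 1) = 0"
    by (rule tensor_relation) (unfold tensor_relations_def, blast)
  then show ?thesis by (simp add: lin_ext_diff lin_ext_single diff_eq_eq add.commute)
qed

lemma tensor_add_right: "\<tau> a (b + b') = \<tau> a b + \<tau> a b'"
proof -
  have "tensor_eval (Poly_Mapping.single (a, b + b') 1 - Poly_Mapping.single (a, b) 1
        - Poly_Mapping.single (a, b') 1) = 0"
    by (rule tensor_relation) (unfold tensor_relations_def, blast)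
  then show ?thesis by (simp add: lin_ext_diff lin_ext_single diff_eq_eq add.commute)
qed

lemma tensor_scale_left: "\<tau> (s c a) b = sT c (\<tau> a b)"
proof -
  have "tensor_eval (Poly_Mapping.single (s c a, b) 1 - Poly_Mapping.single (a, b) c) = 0"
    by (rule tensor_relation) (unfold tensor_relations_def, blast)
  then show ?thesis by (simp add: lin_ext_diff lin_ext_single)
qed

lemma tensor_scale_right: "\<tau> a (t c b) = sT c (\<tau> a b)"
proof -
  have "tensor_eval (Poly_Mapping.single (a, t c b) 1 - Poly_Mapping.single (a, b) c) = 0"
    by (rule tensor_relation) (unfold tensor_relations_def, blast)
  then show ?thesis by (simp add: lin_ext_diff lin_ext_single)
qed

lemma tensor_induct [case_names tensor add]:
  assumes "\<And>a b. P (\<tau> a b)" "\<And>y z. P y \<Longrightarrow> P z \<Longrightarrow> P (y + z)"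
  shows "P y"
proof -
  obtain p where "y = tensor_eval p"
    using tensor by (auto simp: is_tensor_product_def)
  moreover have "P (tensor_eval p)"
  proof (induction p rule: poly_mapping_additive_induct)
    case (single x c)
    then show ?case
      using assms(1) by (cases x) (simp add: lin_ext_single tensor_scale_left[symmetric])
  qed (simp add: lin_ext_add assms(2))
  ultimately show ?thesis by simp
qed

text \<open>A bilinear \<open>\<beta>\<close> kills the tensor relations and therefore their span,
  which is the whole kernel of \<open>tensor_eval\<close>.\<close>

lemma tensor_lift:
  fixes r :: "'k \<Rightarrow> 'z::ab_group_add \<Rightarrow> 'z"
  assumes r: "vector_space r"
    and bilinear: "\<And>a a' b. \<beta> (a + a') b = \<beta> a b + \<beta> a' b"
      "\<And>a b b'. \<beta> a (b + b') = \<beta> a b + \<beta> a b'"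
      "\<And>c a b. \<beta> (s c a) b = r c (\<beta> a b)" "\<And>c a b. \<beta> a (t c b) = r c (\<beta> a b)"
  obtains f where "\<And>p. f (tensor_eval p) = lin_ext r (\<lambda>(a, b). \<beta> a b) p"
proof -
  interpret Z: vector_space r by (rule r)
  interpret F: vector_space "\<lambda>(c::'k) (p :: 'v \<times> 'w \<Rightarrow>\<^sub>0 'k). Poly_Mapping.map ((*) c) p"
    by (rule vector_space_poly_mapping)
  let ?g = "lin_ext r (\<lambda>(a, b). \<beta> a b)"
  have "F.subspace {p. ?g p = 0}"
    by (rule F.subspaceI) (auto simp: Z.lin_ext_zero Z.lin_ext_add Z.lin_ext_map)
  moreover have "tensor_relations s t \<subseteq> {p. ?g p = 0}"
    unfolding tensor_relations_def
    by (auto simp: Z.lin_ext_diff Z.lin_ext_single bilinear)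
  ultimately have "F.span (tensor_relations s t) \<subseteq> {p. ?g p = 0}"
    by (intro F.span_minimal)
  then have ker: "?g p = 0" if "tensor_eval p = 0" for p
    using that tensor by (auto simp: is_tensor_product_def)
  define f where "f y = ?g (SOME p. tensor_eval p = y)" for y
  have "f (tensor_eval p) = ?g p" for p
  proof -
    have "tensor_eval (SOME q. tensor_eval q = tensor_eval p) = tensor_eval p"
      by (rule someI) (rule refl)
    then have "?g ((SOME q. tensor_eval q = tensor_eval p) - p) = 0"
      by (intro ker) (simp add: lin_ext_diff)
    then show ?thesis by (simp add: f_def Z.lin_ext_diff)
  qed
  then show ?thesis by (rule that)
qed

end

section \<open>Evaluating polynomials at commuting elements of a noncommutative ring\<close>

text \<open>Horner evaluation at \<open>X\<close>, with coefficients sent by \<open>h\<close> into a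
  ring that may be noncommutative.\<close>

definition ev :: "('c::zero \<Rightarrow> 'a::ring_1) \<Rightarrow> 'a \<Rightarrow> 'c poly \<Rightarrow> 'a" where
  "ev h X p = fold_coeffs (\<lambda>c y. h c + X * y) p 0"

locale poly_ev =
  fixes h :: "'c::comm_ring_1 \<Rightarrow> 'a::ring_1" and X :: 'a
  assumes h_one: "h 1 = 1" and h_add: "h (a + b) = h a + h b" and h_mult: "h (a * b) = h a * h b"
    and h_commute: "h a * X = X * h a"
begin

lemma h_zero: "h 0 = 0"
  using h_add[of 0 0] by simp

lemma ev_zero: "ev h X 0 = 0"
  by (simp add: ev_def)

lemma ev_pCons: "ev h X (pCons a p) = h a + X * ev h X p"
  by (cases "a = 0"; cases "p = 0") (simp_all add: ev_def h_zero)

lemma ev_const: "ev h X [:a:] = h a"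
  by (simp add: ev_pCons ev_zero)

lemma ev_one: "ev h X 1 = 1"
  by (simp add: one_pCons ev_const h_one)

lemma ev_var: "ev h X [:0, 1:] = X"
  by (simp add: ev_pCons ev_zero h_zero h_one)

lemma ev_add: "ev h X (p + q) = ev h X p + ev h X q"
proof (induction p arbitrary: q)
  case 0
  then show ?case by (simp add: ev_zero)
next
  case (pCons a p)
  show ?case
  proof (cases q)
    case (pCons b q')
    then show ?thesis by (simp add: ev_pCons \<open>\<And>q. ev h X (p + q) = ev h X p + ev h X q\<close> h_add
          algebra_simps)
  qed
qed

lemma ev_smult: "ev h X (smult a p) = h a * ev h X p"
  by (induction p)
     (simp_all add: ev_zero ev_pCons h_mult distrib_left mult.assoc[symmetric] h_commute)

lemma ev_mult: "ev h X (p * q) = ev h X p * ev h X q"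
  by (induction p)
     (simp_all add: ev_zero ev_pCons ev_add ev_smult h_zero distrib_right mult.assoc)

lemma ev_power: "ev h X (p ^ m) = ev h X p ^ m"
  by (induction m) (simp_all add: ev_one ev_mult)

lemma ev_commute:
  assumes "\<And>a. h a * y = y * h a" "X * y = y * X"
  shows "ev h X p * y = y * ev h X p"
proof (induction p)
  case (pCons a p)
  have "X * ev h X p * y = y * (X * ev h X p)"
    by (simp only: mult.assoc pCons.IH) (simp only: mult.assoc[symmetric] assms)
  then show ?case by (simp add: ev_pCons distrib_left distrib_right assms)
qed (simp add: ev_zero)

end

section \<open>The quantum plane and the quantum Weyl algebra over their centers\<close>

definition q_number :: "'k::comm_ring_1 \<Rightarrow> nat \<Rightarrow> 'k" where
  "q_number q m = (\<Sum>i<m. q ^ i)"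

lemma q_number_Suc: "q_number q (Suc m) = q_number q m + q ^ m"
  by (simp add: q_number_def)

lemma q_number_0: "q_number q 0 = 0"
  by (simp add: q_number_def)

lemma q_number_mult: "(q - 1) * q_number q m = q ^ m - 1"
  by (simp add: q_number_def power_diff_1_eq)

lemma has_mult_order_power_eq_1:
  assumes "has_mult_order q n"
  shows "q ^ m = 1 \<longleftrightarrow> n dvd m"
proof -
  have "q ^ m = q ^ (n * (m div n) + m mod n)" by simp
  also have "\<dots> = q ^ (m mod n)"
    using assms by (simp only: power_add power_mult) (simp add: has_mult_order_def)
  finally have "q ^ m = q ^ (m mod n)" .
  moreover have "m mod n < n" using assms by (simp add: has_mult_order_def)
  ultimately show ?thesis
    using assms by (cases "m mod n = 0") (auto simp: has_mult_order_def dvd_eq_mod_eq_0)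
qed

text \<open>As \<open>n > 1\<close>, q differs from 1 and the q-number vanishes exactly when
  \<open>q ^ m - 1\<close> does. Vanishing at n makes n-th powers central or fixed; nonvanishing
  below n keeps the leading coefficients of the action of \<open>x\<close> nonzero.\<close>

lemma q_number_eq_0:
  fixes q :: "'k::field"
  assumes "has_mult_order q n" "n > 1"
  shows "q_number q m = 0 \<longleftrightarrow> n dvd m"
proof -
  have "q \<noteq> 1"
    using has_mult_order_power_eq_1[OF assms(1), of 1] assms(2) by auto
  then have "q_number q m = 0 \<longleftrightarrow> q ^ m = 1"
    using q_number_mult[of q m] by auto
  then show ?thesis using has_mult_order_power_eq_1[OF assms(1)] by simp
qed

section \<open>Operators on k[v][u], with outer variable u and inner variable v, as a model of
  A\<close>

typedef (overloaded) 'k endo = "{f :: 'k::field poly poly \<Rightarrow> 'k poly poly.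
    (\<forall>p q. f (p + q) = f p + f q) \<and> (\<forall>c p. f (smult [:c:] p) = smult [:c:] (f p))}"
  by (rule exI[of _ "\<lambda>p. p"]) simp

setup_lifting type_definition_endo

instantiation endo :: (field) ring_1
begin

lift_definition zero_endo :: "'a endo" is "\<lambda>_. 0" by simp
lift_definition one_endo :: "'a endo" is "\<lambda>p. p" by simp
lift_definition plus_endo :: "'a endo \<Rightarrow> 'a endo \<Rightarrow> 'a endo" is "\<lambda>f g p. f p + g p"
  by (simp add: smult_add_right)
lift_definition minus_endo :: "'a endo \<Rightarrow> 'a endo \<Rightarrow> 'a endo" is "\<lambda>f g p. f p - g p"
  by (simp add: smult_diff_right)
lift_definition uminus_endo :: "'a endo \<Rightarrow> 'a endo" is "\<lambda>f p. - f p"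
  by simp
lift_definition times_endo :: "'a endo \<Rightarrow> 'a endo \<Rightarrow> 'a endo" is "\<lambda>f g p. f (g p)"
  by simp

instance
proof
  show "(0::'a endo) \<noteq> 1"
  proof transfer
    show "(\<lambda>_. 0) \<noteq> (\<lambda>p::'a poly poly. p)"
    proof
      assume "(\<lambda>_. 0) = (\<lambda>p::'a poly poly. p)"
      from fun_cong[OF this, of 1] show False by simp
    qed
  qed
qed (transfer; auto simp: fun_eq_iff ac_simps)+

end

lift_definition endo_scale :: "'k::field \<Rightarrow> 'k endo \<Rightarrow> 'k endo" is "\<lambda>c f p. smult [:c:] (f p)"
  by (simp add: smult_add_right mult.commute)

lemma k_algebra_endo: "k_algebra (endo_scale :: 'k::field \<Rightarrow> 'k endo \<Rightarrow> 'k endo)"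
proof -
  have eq: "smult [:c + d:] p = smult [:c:] p + smult [:d:] p" for c d :: 'k and p
    using smult_add_left[of "[:c:]" "[:d:]" p] by simp
  show ?thesis
  proof
    fix c d :: 'k and f g :: "'k endo"
    show "endo_scale c (f + g) = endo_scale c f + endo_scale c g"
      by transfer (rule ext, rule smult_add_right)
    show "endo_scale (c + d) f = endo_scale c f + endo_scale d f"
      by transfer (rule ext, rule eq)
    show "endo_scale c (endo_scale d f) = endo_scale (c * d) f"
      by transfer (simp add: mult.commute)
    show "endo_scale 1 f = f"
      by transfer (simp add: one_pCons[symmetric])
    show "endo_scale c (f * g) = endo_scale c f * g"
      by transfer simp
    show "endo_scale c (f * g) = f * endo_scale c g"
      by transfer simp
  qed
qed

lift_definition endo_var :: "'k::field endo" is "\<lambda>p. [:0, 1:] * p"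
  by (simp add: algebra_simps)

text \<open>The action of \<open>v\<close> by left multiplication on the basis \<open>u\<^sup>i v\<^sup>j\<close>, in the form
  \<open>v p(u) = p(\<mu>\<^sup>-\<^sup>1 u) v - e (p(u) - p(\<mu>\<^sup>-\<^sup>1 u)) / ((\<mu> - 1) u)\<close>.\<close>

lift_definition endo_qderiv :: "'k::field \<Rightarrow> 'k \<Rightarrow> 'k endo" is
  "\<lambda>\<mu> e p. smult [:0, 1:] (pcompose p [:0, [:inverse \<mu>:]:])
     - smult [:e * inverse (\<mu> - 1):] (poly_shift 1 (p - pcompose p [:0, [:inverse \<mu>:]:]))"
proof -
  fix \<mu> e :: 'k
  let ?D = "\<lambda>p. smult [:0, 1:] (pcompose p [:0, [:inverse \<mu>:]:])
     - smult [:e * inverse (\<mu> - 1):] (poly_shift 1 (p - pcompose p [:0, [:inverse \<mu>:]:]))"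
  define m where "m = [:inverse \<mu>:]"
  define E where "E = [:e * inverse (\<mu> - 1):]"
  define V where "V = [:0, 1 :: 'k:]"
  have D: "coeff (?D p) i = V * (m ^ i * coeff p i)
      - E * (coeff p (Suc i) - m ^ Suc i * coeff p (Suc i))" for p i
    unfolding E_def[symmetric] m_def[symmetric] V_def[symmetric]
    by (simp add: coeff_poly_shift coeff_pcompose_linear)
  have "?D (p + q) = ?D p + ?D q" for p q
    by (rule poly_eqI) (simp only: D coeff_add, simp add: algebra_simps)
  moreover have "?D (smult c p) = smult c (?D p)" for c p
    by (rule poly_eqI) (simp only: D coeff_smult, simp add: algebra_simps)
  ultimately show "(\<forall>p q. ?D (p + q) = ?D p + ?D q) \<and>
      (\<forall>c p. ?D (smult [:c:] p) = smult [:c:] (?D p))"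
    by blast
qed

text \<open>This is the defining relation of A, so A acts on k[v][u] with u as multiplication by the
  outer variable. The proof compares coefficients of powers of u.\<close>

lemma endo_relation:
  assumes "\<mu> \<noteq> 0" "\<mu> \<noteq> 1"
  shows "endo_var * endo_qderiv \<mu> e
       = endo_scale \<mu> (endo_qderiv \<mu> e * endo_var) + endo_scale e 1"
  using assms
proof transfer
  fix \<mu> e :: 'a
  assume \<mu>: "\<mu> \<noteq> 0" "\<mu> \<noteq> 1"
  let ?D = "\<lambda>p. smult [:0, 1:] (pcompose p [:0, [:inverse \<mu>:]:])
     - smult [:e * inverse (\<mu> - 1):] (poly_shift 1 (p - pcompose p [:0, [:inverse \<mu>:]:]))"
  \<comment> \<open>With the constant polynomials made opaque, each coefficient comparison is a ring
    identity modulo \<open>M * m = 1\<close> and \<open>k * (M - 1) = 1\<close>.\<close>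
  define m where "m = [:inverse \<mu>:]"
  define M where "M = [:\<mu>:]"
  define k where "k = [:inverse (\<mu> - 1):]"
  define E where "E = [:e:]"
  define V where "V = [:0, 1 :: 'a:]"
  have Mm: "M * m = 1" and k: "k * (M - 1) = 1"
    using \<mu> by (simp_all add: M_def m_def k_def one_pCons)
  have Ek: "[:e * inverse (\<mu> - 1):] = E * k" by (simp add: E_def k_def)
  have D: "coeff (?D p) i = V * (m ^ i * coeff p i)
      - E * k * (coeff p (Suc i) - m ^ Suc i * coeff p (Suc i))" for p i
    unfolding Ek m_def[symmetric] V_def[symmetric]
    by (simp add: coeff_poly_shift coeff_pcompose_linear)
  have "[:0, 1:] * ?D p = smult M (?D ([:0, 1:] * p)) + smult E p" for p
  proof (rule poly_eqI)
    fix i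
    show "coeff ([:0, 1:] * ?D p) i = coeff (smult M (?D ([:0, 1:] * p)) + smult E p) i"
    proof (cases i)
      case 0
      have "0 = M * (V * 0 - E * k * (x - m * x)) + E * x" for x
      proof -
        have "M * (V * 0 - E * k * (x - m * x)) + E * x = E * x * (1 - k * (M - M * m))"
          by (simp add: algebra_simps)
        then show ?thesis by (simp add: Mm k)
      qed
      then show ?thesis
        using 0 by (simp only: coeff_add coeff_smult D) simp
    next
      case (Suc i')
      \<comment> \<open>Here \<open>w\<close> stands for \<open>m ^ i'\<close>, and \<open>x\<close>
        and \<open>y\<close> for the coefficients of \<open>p\<close> at \<open>i'\<close> and
        \<open>Suc i'\<close>.\<close>
      have eq: "V * (w * x) - E * k * (y - m * w * y)
          = M * (V * (m * w * x) - E * k * (y - m * (m * w) * y)) + E * y" for w x y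
      proof -
        have "M * (V * (m * w * x) - E * k * (y - m * (m * w) * y)) + E * y
            - (V * (w * x) - E * k * (y - m * w * y))
          = V * w * x * (M * m - 1) - E * y * (k * (M - 1) - 1) + E * k * m * w * y * (M * m - 1)"
          by (simp add: algebra_simps)
        then show ?thesis by (simp add: Mm k)
      qed
      have shift: "coeff ([:0, 1:] * q) (Suc i) = coeff q i" for q :: "'a poly poly" and i
        by simp
      show ?thesis
        unfolding Suc coeff_add coeff_smult shift D power_Suc by (rule eq)
    qed
  qed
  then show "(\<lambda>p. [:0, 1:] * ?D p) = (\<lambda>p. smult [:\<mu>:] (?D ([:0, 1:] * p)) + smult [:e:] p)"
    by (simp only: M_def E_def)
qed

lemma endo_qderiv_const: "Rep_endo (endo_qderiv \<mu> e) [:c:] = [:[:0, 1:] * c:]"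
  by transfer (simp add: poly_eq_iff coeff_poly_shift)

lemma coeff_pcompose_monom:
  fixes q :: "'k::comm_ring_1 poly"
  assumes "n > 0"
  shows "coeff (pcompose q (monom 1 n)) i = (if n dvd i then coeff q (i div n) else 0)"
proof (induction q arbitrary: i)
  case (pCons a q)
  show ?case
  proof (cases "i < n")
    case True
    then show ?thesis
      using assms by (auto simp: pcompose_pCons coeff_monom_mult coeff_pCons split: nat.split)
  next
    case False
    then obtain i' where "i = n + i'" by (metis le_iff_add not_less)
    then show ?thesis
      using assms pCons.IH[of i']
      by (auto simp: pcompose_pCons coeff_monom_mult coeff_pCons split: nat.split)
  qed
qed simp

text \<open>For reading off coefficients: u^a times a polynomial in u^n meets the exponent n * i + b
  only if a = b. The inequality guards the truncated subtraction.\<close>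

lemma dvd_add_diff_iff:
  fixes a b n i :: nat
  assumes "a < n" "b < n"
  shows "a \<le> n * i + b \<and> n dvd (n * i + b - a) \<longleftrightarrow> a = b"
proof
  assume A: "a \<le> n * i + b \<and> n dvd (n * i + b - a)"
  then have "a mod n = (n * i + b) mod n"
    by (metis mod_eq_iff_dvd_symdiff_nat dvd_diff_commute mod_eq_dvd_iff_nat)
  then show "a = b" using assms by simp
qed auto

text \<open>The constant \<open>e\<close> treats both algebras at once: it is 0 for the quantum
  plane and 1 for the quantum Weyl algebra.\<close>

locale quantum_algebra = k_algebra s
  for s :: "'k::field \<Rightarrow> 'a::ring_1 \<Rightarrow> 'a" +
  fixes u v :: 'a and \<mu> e :: 'k and n :: nat
  assumes pres: "presented_by s (case_uv_gen u v)
       {gen Gen_u * gen Gen_v - const \<mu> * gen Gen_v * gen Gen_u - const e}"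
    and order_\<mu>: "has_mult_order \<mu> n" and n_gt_1: "n > 1"
begin

section \<open>Commutation rules and central powers\<close>

lemma \<mu>_nonzero: "\<mu> \<noteq> 0"
  using order_\<mu> by (cases "\<mu> = 0") (auto simp: has_mult_order_def power_0_left)

lemma \<mu>_neq_1: "\<mu> \<noteq> 1"
  using has_mult_order_power_eq_1[OF order_\<mu>, of 1] n_gt_1 by auto

lemma n_pos: "n > 0"
  using n_gt_1 by simp

lemma \<mu>_power_n: "\<mu> ^ n = 1"
  using order_\<mu> by (simp add: has_mult_order_def)

lemma relation: "u * v = s \<mu> (v * u) + s e 1"
  using presented_by_relation[OF pres, of "gen Gen_u * gen Gen_v - const \<mu> * gen Gen_v * gen Gen_u - const e"]
  by (simp add: free_eval_simps mult_scale algebra_simps)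

lemma u_power_v: "u ^ m * v = s (\<mu> ^ m) (v * u ^ m) + s (e * q_number \<mu> m) (u ^ (m - 1))"
proof (induction m)
  case (Suc m)
  \<comment> \<open>At \<open>m = 0\<close> the exponent \<open>m - 1\<close> truncates, but its
    coefficient \<open>q_number \<mu> 0\<close> is 0.\<close>
  have um: "s (e * q_number \<mu> m) (u * u ^ (m - 1)) = s (e * q_number \<mu> m) (u ^ m)"
    by (cases m) (simp_all add: q_number_0)
  have "u ^ Suc m * v = u * (u ^ m * v)" by (simp add: mult.assoc)
  also have "\<dots> = s (\<mu> ^ m) (u * v * u ^ m) + s (e * q_number \<mu> m) (u * u ^ (m - 1))"
    by (simp add: Suc.IH distrib_left mult_scale mult.assoc)
  also have "\<dots> = s (\<mu> ^ m) (u * v * u ^ m) + s (e * q_number \<mu> m) (u ^ m)"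
    by (simp only: um)
  also have "\<dots> = s (\<mu> ^ Suc m) (v * u ^ Suc m) + s (e * q_number \<mu> (Suc m)) (u ^ m)"
    by (simp add: relation distrib_right mult_scale mult.assoc q_number_Suc
        scale_left_distrib scale_right_distrib algebra_simps)
  finally show ?case by simp
qed (simp add: q_number_0)

lemma u_v_power: "u * v ^ m = s (\<mu> ^ m) (v ^ m * u) + s (e * q_number \<mu> m) (v ^ (m - 1))"
proof (induction m)
  case (Suc m)
  have vm: "s (e * q_number \<mu> m) (v ^ (m - 1) * v) = s (e * q_number \<mu> m) (v ^ m)"
    by (cases m) (simp_all add: q_number_0 power_commutes)
  have "u * v ^ Suc m = u * v ^ m * v" by (simp add: mult.assoc power_commutes)
  also have "\<dots> = s (\<mu> ^ m) (v ^ m * (u * v)) + s (e * q_number \<mu> m) (v ^ (m - 1) * v)"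
    by (simp add: Suc.IH distrib_right mult_scale mult.assoc)
  also have "\<dots> = s (\<mu> ^ m) (v ^ m * (u * v)) + s (e * q_number \<mu> m) (v ^ m)"
    by (simp only: vm)
  also have "\<dots> = s (\<mu> ^ Suc m) (v ^ m * v * u) + s (e * q_number \<mu> (Suc m)) (v ^ m)"
    by (simp add: relation distrib_left mult_scale mult.assoc q_number_Suc
        scale_left_distrib scale_right_distrib algebra_simps)
  finally show ?case by (simp add: power_commutes mult.assoc)
qed (simp add: q_number_0)

lemma v_u_power:
  "v * u ^ m = s (inverse \<mu> ^ m) (u ^ m * v) - s (inverse \<mu> ^ m * e * q_number \<mu> m) (u ^ (m - 1))"
  using \<mu>_nonzero
  by (simp add: u_power_v scale_right_distrib power_mult_distrib[symmetric] mult.assoc)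

lemma v_power_u:
  "v ^ m * u = s (inverse \<mu> ^ m) (u * v ^ m) - s (inverse \<mu> ^ m * e * q_number \<mu> m) (v ^ (m - 1))"
  using \<mu>_nonzero
  by (simp add: u_v_power scale_right_distrib power_mult_distrib[symmetric] mult.assoc)

lemma q_number_\<mu>_n: "q_number \<mu> n = 0"
  using q_number_eq_0[OF order_\<mu> n_gt_1] by simp

lemma central_if_commutes:
  assumes "y * u = u * y" "y * v = v * y"
  shows "y * a = a * y"
  using pres
proof (induction a rule: presented_by_induct_left)
  case (gen a i)
  have "y * case_uv_gen u v i = case_uv_gen u v i * y"
    using assms by (cases i) simp_all
  then show ?case by (metis gen mult.assoc)
qed (simp_all add: distrib_left distrib_right mult_scale)

text \<open>At exponent n the twist \<open>\<mu> ^ n\<close> is 1 and the correction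
  \<open>q_number \<mu> n\<close> is 0, so u^n commutes with v. The same holds for v^n and
  u.\<close>

lemma u_power_n_central: "u ^ n * a = a * u ^ n"
  by (rule central_if_commutes)
     (simp_all add: power_commutes u_power_v \<mu>_power_n q_number_\<mu>_n)

lemma v_power_n_central: "v ^ n * a = a * v ^ n"
  by (rule central_if_commutes)
     (simp_all add: power_commutes u_v_power \<mu>_power_n q_number_\<mu>_n)

section \<open>The central subring R = k[u^n, v^n]\<close>

abbreviation iota0 :: "'k poly \<Rightarrow> 'a" where
  "iota0 \<equiv> ev (\<lambda>c. s c 1) (v ^ n)"

text \<open>The embedding of R into A: the outer variable goes to u^n and the inner one to
  v^n.\<close>

definition iota :: "'k poly poly \<Rightarrow> 'a" where
  "iota = ev iota0 (u ^ n)"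

sublocale inner: poly_ev "\<lambda>c. s c 1" "v ^ n"
  by unfold_locales (simp_all add: scale_left_distrib mult_scale)

sublocale outer: poly_ev iota0 "u ^ n"
  by unfold_locales (simp_all add: inner.ev_one inner.ev_add inner.ev_mult u_power_n_central)

lemmas iota_one = outer.ev_one[folded iota_def]
  and iota_zero = outer.ev_zero[folded iota_def]
  and iota_add = outer.ev_add[folded iota_def]
  and iota_mult = outer.ev_mult[folded iota_def]
  and iota_power = outer.ev_power[folded iota_def]
  and iota_pCons = outer.ev_pCons[folded iota_def]
  and iota_const = outer.ev_const[folded iota_def]
  and iota_U = outer.ev_var[folded iota_def]

lemma iota_V: "iota [:[:0, 1:]:] = v ^ n"
  by (simp add: iota_const inner.ev_var)

lemma iota_scalar: "iota [:[:c:]:] = s c 1"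
  by (simp add: iota_const inner.ev_const)

lemma iota_central: "iota p * a = a * iota p"
proof -
  have "iota0 q * a = a * iota0 q" for q
    by (rule inner.ev_commute) (simp_all add: mult_scale v_power_n_central)
  then show ?thesis
    unfolding iota_def by (intro outer.ev_commute) (simp_all add: u_power_n_central)
qed

lemma iota_uminus: "iota (- p) = - iota p"
  using iota_add[of p "- p"] by (simp add: iota_zero eq_neg_iff_add_eq_0 add.commute)

lemma iota_diff: "iota (p - q) = iota p - iota q"
  using iota_add[of p "- q"] by (simp add: iota_uminus)

text \<open>The index sorts monomials by their degree in v first; the later triangularity depends on
  this order.\<close>

definition r :: "nat \<Rightarrow> 'a" where
  "r l = u ^ (l mod n) * v ^ (l div n)"

section \<open>Freeness of A over R\<close>

definition combos :: "'a set" where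
  "combos = range (\<lambda>c. \<Sum>l<n * n. iota (c l) * r l)"

lemma combos_add: "x \<in> combos \<Longrightarrow> y \<in> combos \<Longrightarrow> x + y \<in> combos"
proof -
  assume "x \<in> combos" "y \<in> combos"
  then obtain c d where "x = (\<Sum>l<n * n. iota (c l) * r l)" "y = (\<Sum>l<n * n. iota (d l) * r l)"
    by (auto simp: combos_def)
  then have "x + y = (\<Sum>l<n * n. iota (c l + d l) * r l)"
    by (simp add: iota_add distrib_right sum.distrib)
  then show ?thesis by (auto simp: combos_def)
qed

lemma combos_iota: "x \<in> combos \<Longrightarrow> iota p * x \<in> combos"
proof -
  assume "x \<in> combos"
  then obtain c where "x = (\<Sum>l<n * n. iota (c l) * r l)" by (auto simp: combos_def)
  then have "iota p * x = (\<Sum>l<n * n. iota (p * c l) * r l)"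
    by (simp add: iota_mult sum_distrib_left mult.assoc)
  then show ?thesis by (auto simp: combos_def)
qed

lemma combos_scale: "x \<in> combos \<Longrightarrow> s c x \<in> combos"
  using combos_iota[of x "[:[:c:]:]"] by (simp add: iota_scalar mult_scale)

lemma combos_zero: "0 \<in> combos"
proof -
  have "(\<Sum>l<n * n. iota 0 * r l) = 0" by (simp add: iota_zero)
  then show ?thesis
    unfolding combos_def by (intro range_eqI[of _ _ "\<lambda>_. 0"]) simp
qed

lemma combos_sum: "(\<And>i. i \<in> S \<Longrightarrow> f i \<in> combos) \<Longrightarrow> sum f S \<in> combos"
  by (induction S rule: infinite_finite_induct) (simp_all add: combos_zero combos_add)

lemma combos_r:
  assumes "l < n * n"
  shows "r l \<in> combos"
proof -
  have "r l = (\<Sum>l'<n * n. if l' = l then r l' else 0)" using assms by simp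
  also have "\<dots> = (\<Sum>l'<n * n. iota (if l' = l then 1 else 0) * r l')"
    by (intro sum.cong) (simp_all add: iota_one iota_zero)
  finally show ?thesis unfolding combos_def by (rule range_eqI[of _ _ "\<lambda>l'. if l' = l then 1 else 0"])
qed

lemma combos_monomial: "u ^ i * v ^ j \<in> combos"
proof -
  have "u ^ i = u ^ (i mod n) * (u ^ n) ^ (i div n)"
    unfolding power_mult[symmetric] power_add[symmetric] mod_mult_div_eq ..
  moreover have "v ^ j = (v ^ n) ^ (j div n) * v ^ (j mod n)"
    unfolding power_mult[symmetric] power_add[symmetric] mult_div_mod_eq ..
  ultimately have "u ^ i * v ^ j
      = u ^ (i mod n) * (u ^ n) ^ (i div n) * ((v ^ n) ^ (j div n) * v ^ (j mod n))"
    by (rule arg_cong2)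
  also have "\<dots> = u ^ (i mod n) * iota ([:0, 1:] ^ (i div n) * [:[:0, 1:]:] ^ (j div n)) * v ^ (j mod n)"
    by (simp only: iota_mult iota_power iota_U iota_V mult.assoc)
  also have "\<dots> = iota ([:0, 1:] ^ (i div n) * [:[:0, 1:]:] ^ (j div n)) * r (j mod n * n + i mod n)"
    unfolding iota_central[of _ "u ^ (i mod n)", symmetric]
    using n_pos by (simp add: r_def mult.assoc)
  finally show ?thesis
    using n_pos by (auto intro!: combos_iota combos_r mult_add_less_mult)
qed

lemma combos_diff: "x \<in> combos \<Longrightarrow> y \<in> combos \<Longrightarrow> x - y \<in> combos"
  using combos_add[of x "s (-1) y"] combos_scale[of y "-1"] by simp

text \<open>The R-span of the monomials contains 1 and is closed under left multiplication by u and
  v; for v, the commutation rule moves v to the right of the powers of u.\<close>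

lemma spanning_r: obtains c where "a = (\<Sum>l<n * n. iota (c l) * r l)"
proof -
  have left: "w * a \<in> combos" if a: "a \<in> combos" and w: "w = u \<or> w = v" for w a
  proof -
    obtain c where c: "a = (\<Sum>l<n * n. iota (c l) * r l)" using a by (auto simp: combos_def)
    have mono: "w * r l \<in> combos" for l
    proof (cases "w = u")
      case True
      then have "w * r l = u ^ Suc (l mod n) * v ^ (l div n)" by (simp add: r_def mult.assoc)
      then show ?thesis using combos_monomial[of "Suc (l mod n)" "l div n"] by simp
    next
      case False
      then have "w * r l = v * u ^ (l mod n) * v ^ (l div n)"
        using w by (simp add: r_def mult.assoc)
      also have "\<dots> = s (inverse \<mu> ^ (l mod n)) (u ^ (l mod n) * v ^ Suc (l div n))
          - s (inverse \<mu> ^ (l mod n) * e * q_number \<mu> (l mod n)) (u ^ (l mod n - 1) * v ^ (l div n))"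
        by (simp add: v_u_power left_diff_distrib mult_scale mult.assoc)
      finally show ?thesis
        by (simp only:) (intro combos_diff combos_scale combos_monomial)
    qed
    have "w * a = (\<Sum>l<n * n. iota (c l) * (w * r l))"
      unfolding c sum_distrib_left by (simp only: mult.assoc[symmetric] iota_central[of _ w])
    then show ?thesis by (simp only:) (intro combos_sum combos_iota mono)
  qed
  have "a \<in> combos"
    using pres
  proof (induction a rule: presented_by_induct_left)
    case one
    show ?case using combos_monomial[of 0 0] by simp
  next
    case (gen a i)
    then show ?case by (cases i) (simp_all add: left)
  qed (simp_all add: combos_add combos_scale)
  then show ?thesis using that by (auto simp: combos_def)
qed

text \<open>\<open>\<theta> a\<close> is the result of applying the operator of \<open>a\<close> to
  the polynomial 1. It turns an ordered monomial of A into the same monomial of k[v][u], so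
  independence can be tested on polynomials.\<close>

lemma model_obtain:
  obtains \<theta> :: "'a \<Rightarrow> 'k poly poly"
  where "\<And>a b. \<theta> (a + b) = \<theta> a + \<theta> b"
    and "\<And>a. \<theta> (u * a) = [:0, 1:] * \<theta> a"
    and "\<And>q b. \<theta> (iota0 q * v ^ b) = [:pcompose q (monom 1 n) * monom 1 b:]"
proof -
  let ?\<phi> = "case_uv_gen endo_var (endo_qderiv \<mu> e)"
  interpret E: k_algebra endo_scale by (rule k_algebra_endo)
  have rel: "free_eval endo_scale ?\<phi> p = 0"
    if "p \<in> {gen Gen_u * gen Gen_v - const \<mu> * gen Gen_v * gen Gen_u - const e}" for p
    using that endo_relation[OF \<mu>_nonzero \<mu>_neq_1, of e]
    by (simp add: E.free_eval_simps E.mult_scale)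
  obtain \<psi> :: "'a \<Rightarrow> 'k endo" where \<psi>: "\<And>i. \<psi> (case_uv_gen u v i) = ?\<phi> i"
    "\<psi> 1 = 1" "\<And>a b. \<psi> (a * b) = \<psi> a * \<psi> b"
    "\<And>a b. \<psi> (a + b) = \<psi> a + \<psi> b" "\<And>c a. \<psi> (s c a) = endo_scale c (\<psi> a)"
    using presented_by_hom[OF pres k_algebra_endo rel] by blast
  have \<psi>u: "\<psi> u = endo_var" and \<psi>v: "\<psi> v = endo_qderiv \<mu> e"
    using \<psi>(1)[of Gen_u] \<psi>(1)[of Gen_v] by simp_all
  have times: "Rep_endo (f * g) p = Rep_endo f (Rep_endo g p)" for f g :: "'k endo" and p
    by transfer simp
  have plus: "Rep_endo (f + g) p = Rep_endo f p + Rep_endo g p" for f g :: "'k endo" and p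
    by transfer simp
  have sc: "Rep_endo (endo_scale c f) p = smult [:c:] (Rep_endo f p)" for c :: 'k and f p
    by transfer simp
  have var: "Rep_endo endo_var p = [:0, 1:] * p" for p :: "'k poly poly"
    by transfer simp
  have one: "Rep_endo 1 p = p" for p :: "'k poly poly"
    by transfer simp
  define \<theta> where "\<theta> a = Rep_endo (\<psi> a) 1" for a
  \<comment> \<open>On polynomials without u, the operator of v is plain multiplication by the inner
    variable.\<close>
  have vpow: "Rep_endo (\<psi> (v ^ b)) [:c:] = [:monom 1 b * c:]" for b c
  proof (induction b)
    case (Suc b)
    have "Rep_endo (\<psi> (v ^ Suc b)) [:c:] = [:[:0, 1:] * (monom 1 b * c):]"
      by (simp only: power_Suc \<psi>(3) times Suc \<psi>v endo_qderiv_const)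
    then show ?case by (simp add: monom_Suc)
  qed (simp add: \<psi> one)
  show ?thesis
  proof
    show "\<theta> (a + b) = \<theta> a + \<theta> b" for a b
      by (simp add: \<theta>_def \<psi> plus)
    show "\<theta> (u * a) = [:0, 1:] * \<theta> a" for a
      by (simp add: \<theta>_def \<psi> times \<psi>u var)
    have "Rep_endo (\<psi> (iota0 q)) [:c:] = [:pcompose q (monom 1 n) * c:]" for q c
    proof (induction q arbitrary: c)
      case 0
      have "\<psi> 0 = 0" using \<psi>(4)[of 0 0] by simp
      then show ?case by (simp add: inner.ev_zero) (transfer, simp)
    next
      case (pCons a q)
      show ?case
        by (simp add: inner.ev_pCons \<psi>(3-5) \<psi>(2) plus times sc one pCons.IH vpow pcompose_pCons
            algebra_simps)
    qed
    then show "\<theta> (iota0 q * v ^ b) = [:pcompose q (monom 1 n) * monom 1 b:]" for q b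
      by (simp add: \<theta>_def \<psi> times vpow one_pCons[of] )
  qed
qed

text \<open>In the model, the term with index l only involves u and v exponents congruent mod n to
  \<open>l mod n\<close> and \<open>l div n\<close>. Different terms thus have no monomial in
  common, and each coefficient of \<open>c l\<close> can be read off.\<close>

lemma independent_r:
  assumes 0: "(\<Sum>l<n * n. iota (c l) * r l) = 0" and l: "l < n * n"
  shows "c l = 0"
proof -
  obtain \<theta> :: "'a \<Rightarrow> 'k poly poly" where \<theta>_add: "\<And>a b. \<theta> (a + b) = \<theta> a + \<theta> b"
    and \<theta>_u: "\<And>a. \<theta> (u * a) = [:0, 1:] * \<theta> a"
    and \<theta>_v: "\<And>q b. \<theta> (iota0 q * v ^ b) = [:pcompose q (monom 1 n) * monom 1 b:]"
    by (rule model_obtain) blast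
  have \<theta>_zero: "\<theta> 0 = 0"
    using \<theta>_add[of 0 0] by (metis add.right_neutral add_left_imp_eq)
  have \<theta>_sum: "\<theta> (sum f S) = (\<Sum>i\<in>S. \<theta> (f i))" for f and S :: "nat set"
    by (induction S rule: infinite_finite_induct) (simp_all add: \<theta>_zero \<theta>_add)
  have \<theta>_upow: "\<theta> (u ^ a * y) = monom 1 a * \<theta> y" for a y
  proof (induction a)
    case (Suc a)
    then show ?case by (simp add: mult.assoc \<theta>_u monom_Suc)
  qed simp
  have outer: "coeff (\<theta> (iota p * v ^ b)) i
      = (if n dvd i then pcompose (coeff p (i div n)) (monom 1 n) * monom 1 b else 0)" for p b i
  proof (induction p arbitrary: i)
    case 0
    then show ?case by (simp add: iota_zero \<theta>_zero)
  next
    case (pCons a p)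
    have "\<theta> (iota (pCons a p) * v ^ b)
        = [:pcompose a (monom 1 n) * monom 1 b:] + monom 1 n * \<theta> (iota p * v ^ b)"
      by (simp add: iota_pCons distrib_right mult.assoc \<theta>_add \<theta>_v \<theta>_upow)
    note eq = this
    show ?case
    proof (cases "i < n")
      case True
      then show ?thesis
        using n_pos by (auto simp: eq coeff_monom_mult coeff_pCons split: nat.split)
    next
      case False
      then obtain i' where "i = n + i'" by (metis le_iff_add not_less)
      then show ?thesis
        using n_pos pCons.IH[of i']
        by (auto simp: eq coeff_monom_mult coeff_pCons split: nat.split)
    qed
  qed
  \<comment> \<open>Exponents are split as a quotient by n, the position in \<open>p\<close>, and a
    residue, the basis monomial.\<close>
  have coeff_theta: "coeff (coeff (\<theta> (iota p * (u ^ a * v ^ b))) (n * i + a')) (n * j + b')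
      = (if a = a' \<and> b = b' then coeff (coeff p i) j else 0)"
    if "a < n" "a' < n" "b < n" "b' < n" for p a a' b b' i j
  proof -
    have eq: "iota p * (u ^ a * v ^ b) = u ^ a * (iota p * v ^ b)"
      by (metis iota_central mult.assoc)
    show ?thesis
    proof (cases "a = a' \<and> b = b'")
      case True
      then show ?thesis
        unfolding eq \<theta>_upow using n_pos
        by (simp add: coeff_monom_mult outer mult.commute[of _ "monom 1 b'"]
            coeff_pcompose_monom)
    next
      case False
      then have "\<not> (a \<le> n * i + a' \<and> n dvd (n * i + a' - a)) \<or>
         \<not> (b \<le> n * j + b' \<and> n dvd (n * j + b' - b))"
        using that by (simp only: dvd_add_diff_iff) auto
      then show ?thesis
        unfolding eq \<theta>_upow using n_pos False
        by (auto simp: coeff_monom_mult outer mult.commute[of _ "monom 1 b"]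
            coeff_pcompose_monom)
    qed
  qed
  have "coeff (coeff (c l) i) j = 0" for i j
  proof -
    let ?x = "\<lambda>y. coeff (coeff (\<theta> y) (n * i + l mod n)) (n * j + l div n)"
    have ld: "l mod n < n" "l div n < n" using l n_pos by (auto simp: less_mult_imp_div_less)
    have "0 = ?x (\<Sum>l'<n * n. iota (c l') * r l')" by (simp add: 0 \<theta>_zero)
    also have "\<dots> = (\<Sum>l'<n * n. ?x (iota (c l') * r l'))" by (simp add: \<theta>_sum coeff_sum)
    also have "\<dots> = (\<Sum>l'<n * n. if l' = l then coeff (coeff (c l') i) j else 0)"
    proof (rule sum.cong)
      fix l' assume "l' \<in> {..<n * n}"
      then have "l' mod n < n" "l' div n < n" using n_pos by (auto simp: less_mult_imp_div_less)
      moreover have "l' mod n = l mod n \<and> l' div n = l div n \<longleftrightarrow> l' = l"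
        by (metis div_mult_mod_eq)
      ultimately show "?x (iota (c l') * r l') = (if l' = l then coeff (coeff (c l') i) j else 0)"
        unfolding r_def using ld by (simp add: coeff_theta)
    qed simp
    finally show ?thesis using l by simp
  qed
  then show ?thesis by (simp add: poly_eq_iff)
qed

lemma independent_r_eq:
  assumes "(\<Sum>l<n * n. iota (c l) * r l) = (\<Sum>l<n * n. iota (d l) * r l)" "l < n * n"
  shows "c l = d l"
proof -
  have "(\<Sum>l<n * n. iota (c l - d l) * r l) = 0"
    using assms(1) by (simp add: iota_diff left_diff_distrib sum_subtractf)
  from independent_r[OF this assms(2)] show ?thesis by simp
qed

text \<open>Only the values below n * n are determined; the others are arbitrary, whence the bounds
  on \<open>l\<close> in what follows.\<close>

definition coordA :: "'a \<Rightarrow> nat \<Rightarrow> 'k poly poly" where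
  "coordA a = (SOME c. a = (\<Sum>l<n * n. iota (c l) * r l))"

lemma coordA_sum: "a = (\<Sum>l<n * n. iota (coordA a l) * r l)"
proof -
  obtain c where "a = (\<Sum>l<n * n. iota (c l) * r l)" by (rule spanning_r)
  then have "\<exists>c. a = (\<Sum>l<n * n. iota (c l) * r l)" by blast
  from someI_ex[OF this] show ?thesis unfolding coordA_def .
qed

lemma coordA_eqI: "a = (\<Sum>l<n * n. iota (c l) * r l) \<Longrightarrow> l < n * n \<Longrightarrow> coordA a l = c l"
  by (rule independent_r_eq) (simp_all add: coordA_sum[symmetric])

lemma coordA_add: "l < n * n \<Longrightarrow> coordA (a + b) l = coordA a l + coordA b l"
  by (rule coordA_eqI)
     (simp_all add: iota_add distrib_right sum.distrib coordA_sum[symmetric])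

lemma coordA_iota: "l < n * n \<Longrightarrow> coordA (iota p * a) l = p * coordA a l"
  by (rule coordA_eqI)
     (simp_all add: iota_mult mult.assoc sum_distrib_left[symmetric] coordA_sum[symmetric])

lemma coordA_zero: "l < n * n \<Longrightarrow> coordA 0 l = 0"
  using coordA_iota[of l 0 0] by (simp add: iota_zero)

lemma coordA_sum_fun:
  assumes "l < n * n"
  shows "coordA (sum f S) l = (\<Sum>i\<in>S. coordA (f i) l)"
  by (induction S rule: infinite_finite_induct)
     (simp_all add: coordA_zero coordA_add assms)

lemma coordA_r: "l < n * n \<Longrightarrow> l' < n * n \<Longrightarrow> coordA (r l') l = (if l = l' then 1 else 0)"
proof (rule coordA_eqI)
  assume "l' < n * n"
  then have "r l' = (\<Sum>l<n * n. if l = l' then r l else 0)" by simp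
  also have "\<dots> = (\<Sum>l<n * n. iota (if l = l' then 1 else 0) * r l)"
    by (intro sum.cong) (simp_all add: iota_one iota_zero)
  finally show "r l' = (\<Sum>l<n * n. iota (if l = l' then 1 else 0) * r l)" .
qed

lemma iota_inj: "iota p = iota q \<Longrightarrow> p = q"
proof -
  assume pq: "iota p = iota q"
  have 0: "0 < n * n" using n_pos by simp
  have "r 0 = 1" by (simp add: r_def)
  then have "coordA (iota p) 0 = p" for p
    using coordA_iota[OF 0, of p "r 0"] coordA_r[OF 0 0] by simp
  then show "p = q" using pq by metis
qed

end

section \<open>The action of the Taft algebra\<close>

text \<open>\<open>e_lam\<close> expresses \<lambda> = \<mu>^(-2) in the Weyl case and is vacuous
  for \<open>e = 0\<close>.\<close>

locale taft_action = quantum_algebra s u v \<mu> e n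
  for s :: "'k::field_char_0 \<Rightarrow> 'a::ring_1 \<Rightarrow> 'a" and u v \<mu> e n +
  fixes lam \<eta> :: 'k and H :: "('k, 'h::ring_1, 't::ring_1) hopf" and g x :: 'h
    and act :: "'h \<Rightarrow> 'a \<Rightarrow> 'a"
  assumes taft: "taft_algebra n lam H g x" and order_lam: "has_mult_order lam n"
    and e_lam: "e \<noteq> 0 \<Longrightarrow> lam * \<mu> ^ 2 = 1"
    and action: "hopf_action H s act"
    and g_u: "act g u = s \<mu> u" and g_v: "act g v = s (lam * \<mu>) v"
    and x_u: "act x u = 0" and \<eta>_nonzero: "\<eta> \<noteq> 0" and x_v: "act x v = s \<eta> u"
begin

abbreviation sH :: "'k \<Rightarrow> 'h \<Rightarrow> 'h" where "sH \<equiv> hscale H"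

lemma presH: "presented_by sH (case_taft_gen g x)
       {gen Gen_g ^ n - 1, gen Gen_x ^ n,
        gen Gen_x * gen Gen_g - const lam * gen Gen_g * gen Gen_x}"
  using taft by (simp add: taft_algebra_def)

sublocale HA: k_algebra sH
  using presH by (simp add: presented_by_def)

sublocale HT: tensor_product sH sH "tscale H" "tensor H"
  using taft by unfold_locales (simp add: taft_algebra_def tensor_square_def)

lemma g_power_n: "g ^ n = 1"
  using presented_by_relation[OF presH, of "gen Gen_g ^ n - 1"] by (simp add: HA.free_eval_simps)

lemma x_power_n: "x ^ n = 0"
  using presented_by_relation[OF presH, of "gen Gen_x ^ n"] by (simp add: HA.free_eval_simps)

lemma x_g: "x * g = sH lam (g * x)"
  using presented_by_relation[OF presH, of "gen Gen_x * gen Gen_g - const lam * gen Gen_g * gen Gen_x"]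
  by (simp add: HA.free_eval_simps HA.mult_scale)

lemma x_power_g: "x ^ m * g = sH (lam ^ m) (g * x ^ m)"
proof (induction m)
  case (Suc m)
  have "x ^ Suc m * g = x * (x ^ m * g)" by (simp add: mult.assoc)
  also have "\<dots> = sH (lam ^ m) (x * g * x ^ m)" by (simp add: Suc HA.mult_scale mult.assoc)
  also have "\<dots> = sH (lam ^ Suc m) (g * x ^ Suc m)"
    by (simp add: x_g HA.mult_scale mult.assoc mult.commute)
  finally show ?case .
qed simp

lemma act_add_left: "act (h + h') a = act h a + act h' a"
  and act_scale_left: "act (sH c h) a = s c (act h a)"
proof -
  have "Vector_Spaces.linear sH s (\<lambda>h. act h a)"
    using action by (simp add: hopf_action_def)
  then interpret f: Vector_Spaces.linear sH s "\<lambda>h. act h a" .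
  show "act (h + h') a = act h a + act h' a" "act (sH c h) a = s c (act h a)"
    by (fact f.add f.scale)+
qed

lemma act_linear: "Vector_Spaces.linear s s (act h)"
  using action by (simp add: hopf_action_def)

lemma act_add: "act h (a + b) = act h a + act h b"
  and act_scale: "act h (s c a) = s c (act h a)"
  and act_diff: "act h (a - b) = act h a - act h b"
  and act_zero: "act h 0 = 0"
  and act_sum: "act h (sum f S) = (\<Sum>i\<in>S. act h (f i))"
proof -
  interpret f: Vector_Spaces.linear s s "act h" by (rule act_linear)
  show "act h (a + b) = act h a + act h b" "act h (s c a) = s c (act h a)"
    "act h (a - b) = act h a - act h b" "act h 0 = 0"
    "act h (sum f S) = (\<Sum>i\<in>S. act h (f i))"
    by (fact f.add f.scale f.diff f.zero f.sum)+
qed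

lemma act_one: "act 1 a = a"
  using action by (simp add: hopf_action_def)

lemma act_mult_left: "act (h * h') a = act h (act h' a)"
  using action by (simp add: hopf_action_def)

lemma act_unit: "act h 1 = s (counit H h) 1"
  using action by (simp add: hopf_action_def)

lemma act_sweedler:
  "sweedler H h p \<Longrightarrow> act h (a * b) = lin_ext s (\<lambda>(h1, h2). act h1 a * act h2 b) p"
  using action unfolding hopf_action_def by blast

lemma act_zero_left: "act 0 a = 0"
  using act_scale_left[of 0 0 a] by simp

lemma act_sum_left: "act (sum f S) a = (\<Sum>i\<in>S. act (f i) a)"
  by (induction S rule: infinite_finite_induct) (simp_all add: act_zero_left act_add_left)

text \<open>The coproduct of g is a single tensor, so g acts multiplicatively; the coproduct of x
  makes x act as a derivation twisted by g.\<close>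

lemma act_g_mult: "act g (a * b) = act g a * act g b"
proof -
  have "sweedler H g (Poly_Mapping.single (g, g) 1)"
    using taft by (simp add: sweedler_def HT.lin_ext_single taft_algebra_def)
  then show ?thesis by (simp add: act_sweedler lin_ext_single)
qed

lemma act_x_mult: "act x (a * b) = act g a * act x b + act x a * b"
proof -
  have "sweedler H x (Poly_Mapping.single (g, x) 1 + Poly_Mapping.single (x, 1) 1)"
    using taft by (simp add: sweedler_def HT.lin_ext_single HT.lin_ext_add taft_algebra_def)
  then show ?thesis by (simp add: act_sweedler lin_ext_single lin_ext_add act_one)
qed

lemma act_g_one: "act g 1 = 1"
  using taft by (simp add: act_unit taft_algebra_def)

lemma act_x_one: "act x 1 = 0"
  using taft by (simp add: act_unit taft_algebra_def)

section \<open>The action on powers of u and v\<close>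

lemma g_u_power: "act g (u ^ m) = s (\<mu> ^ m) (u ^ m)"
  by (induction m) (simp_all add: act_g_one act_g_mult g_u mult_scale)

lemma g_v_power: "act g (v ^ m) = s ((lam * \<mu>) ^ m) (v ^ m)"
  by (induction m) (simp_all add: act_g_one act_g_mult g_v mult_scale)

lemma x_u_power_mult: "act x (u ^ m * a) = s (\<mu> ^ m) (u ^ m * act x a)"
proof (induction m)
  case (Suc m)
  have "act x (u ^ Suc m * a) = act x (u * (u ^ m * a))" by (simp add: mult.assoc)
  also have "\<dots> = s \<mu> (u * act x (u ^ m * a))"
    by (subst act_x_mult) (simp add: g_u x_u mult_scale)
  finally show ?case by (simp add: Suc mult_scale mult.assoc)
qed simp

text \<open>The coefficient of the correction that the relation with \<open>e\<close> contributes
  when u is moved to the left of the powers of v.\<close>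

definition t_number :: "nat \<Rightarrow> 'k" where
  "t_number m = (\<Sum>i<m. lam ^ i * q_number \<mu> i)"

lemma x_v_power:
  "act x (v ^ m) = s (\<eta> * q_number lam m) (u * v ^ (m - 1))
     - s (\<eta> * e * t_number m) (v ^ (m - 2))"
proof (induction m)
  case 0
  then show ?case by (simp add: act_x_one q_number_0 t_number_def)
next
  case (Suc m)
  have lm: "(lam * \<mu>) ^ m * inverse \<mu> ^ m = lam ^ m"
    using \<mu>_nonzero by (simp add: power_mult_distrib[symmetric] mult.assoc)
  have 1: "s (\<eta> * q_number lam m) (u * v ^ (m - 1) * v) = s (\<eta> * q_number lam m) (u * v ^ m)"
    by (cases m) (simp_all add: q_number_0 mult.assoc power_commutes)
  \<comment> \<open>For m < 2 the exponent \<open>m - 2\<close> truncates, but there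
    \<open>t_number m\<close> is 0.\<close>
  have 2: "s (\<eta> * e * t_number m) (v ^ (m - 2) * v) = s (\<eta> * e * t_number m) (v ^ (m - 1))"
  proof (cases "m < 2")
    case True
    then have "t_number m = 0" by (cases m) (auto simp: t_number_def q_number_0 less_Suc_eq)
    then show ?thesis by simp
  next
    case False
    then obtain m' where "m = Suc (Suc m')" by (metis less_2_cases_iff not0_implies_Suc One_nat_def)
    then show ?thesis by (simp add: power_commutes)
  qed
  have "act x (v ^ Suc m) = act x (v ^ m * v)" by (simp add: power_commutes)
  also have "\<dots> = s ((lam * \<mu>) ^ m * \<eta>) (v ^ m * u) + act x (v ^ m) * v"
    by (subst act_x_mult) (simp add: g_v_power x_v mult_scale mult.commute)
  also have "s ((lam * \<mu>) ^ m * \<eta>) (v ^ m * u)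
      = s (\<eta> * ((lam * \<mu>) ^ m * inverse \<mu> ^ m)) (u * v ^ m)
        - s (\<eta> * e * ((lam * \<mu>) ^ m * inverse \<mu> ^ m * q_number \<mu> m)) (v ^ (m - 1))"
    unfolding v_power_u by (simp add: scale_right_diff_distrib ac_simps)
  also have "act x (v ^ m) * v = s (\<eta> * q_number lam m) (u * v ^ (m - 1) * v)
      - s (\<eta> * e * t_number m) (v ^ (m - 2) * v)"
    unfolding Suc by (simp add: left_diff_distrib mult_scale)
  also have "s (\<eta> * ((lam * \<mu>) ^ m * inverse \<mu> ^ m)) (u * v ^ m)
        - s (\<eta> * e * ((lam * \<mu>) ^ m * inverse \<mu> ^ m * q_number \<mu> m)) (v ^ (m - 1))
        + (s (\<eta> * q_number lam m) (u * v ^ (m - 1) * v)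
           - s (\<eta> * e * t_number m) (v ^ (m - 2) * v))
      = s (\<eta> * q_number lam (Suc m)) (u * v ^ m) - s (\<eta> * e * t_number (Suc m)) (v ^ (m - 1))"
    unfolding lm 1 2
    by (simp add: q_number_Suc t_number_def scale_left_distrib distrib_left)
  finally show ?case by (simp add: numeral_2_eq_2)
qed

lemma q_number_lam_n: "q_number lam n = 0"
  using q_number_eq_0[OF order_lam n_gt_1] by simp

text \<open>Here \<open>\<lambda> = \<mu>\<^sup>-\<^sup>2\<close> enters: the geometric sums of \<open>\<lambda>\<close> and of \<open>\<lambda> \<mu> = \<mu>\<^sup>-\<^sup>1\<close> both vanish.\<close>

lemma t_number_n:
  assumes "e \<noteq> 0"
  shows "t_number n = 0"
proof -
  have "(\<mu> - 1) * t_number n = (\<Sum>i<n. (lam * \<mu>) ^ i - lam ^ i)"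
    unfolding t_number_def sum_distrib_left
  proof (rule sum.cong)
    fix i
    have eq: "(\<mu> - 1) * (lam ^ i * q_number \<mu> i) = lam ^ i * ((\<mu> - 1) * q_number \<mu> i)"
      by (simp only: ac_simps)
    show "(\<mu> - 1) * (lam ^ i * q_number \<mu> i) = (lam * \<mu>) ^ i - lam ^ i"
      unfolding eq q_number_mult by (simp add: right_diff_distrib power_mult_distrib)
  qed simp
  also have "\<dots> = q_number (lam * \<mu>) n - q_number lam n"
    by (simp add: q_number_def sum_subtractf)
  also have "q_number (lam * \<mu>) n = 0"
  proof -
    have lm: "lam * \<mu> * \<mu> = 1" using e_lam[OF assms] by (simp add: power2_eq_square mult.assoc)
    then have "lam * \<mu> \<noteq> 1" using \<mu>_neq_1 by auto
    moreover have "(lam * \<mu>) ^ n = 1"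
      using order_lam \<mu>_power_n by (simp add: power_mult_distrib has_mult_order_def)
    ultimately show ?thesis using q_number_mult[of "lam * \<mu>" n] by simp
  qed
  finally show ?thesis using \<mu>_neq_1 q_number_lam_n by simp
qed

lemma x_v_power_n: "act x (v ^ n) = 0"
  using t_number_n by (cases "e = 0") (simp_all add: x_v_power q_number_lam_n)

section \<open>The filtration by degree in v\<close>

definition filtration :: "nat \<Rightarrow> 'a set" where
  "filtration m = span {u ^ i * v ^ j | i j. j < m}"

lemma filtration_monomial: "j < m \<Longrightarrow> u ^ i * v ^ j \<in> filtration m"
  unfolding filtration_def by (rule span_base) blast

text \<open>The strict bound on the degree makes the bottom step zero, so lowering the degree far
  enough proves vanishing.\<close>

lemma filtration_0: "filtration 0 = {0}"
  by (simp add: filtration_def)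

lemma filtration_add: "a \<in> filtration m \<Longrightarrow> b \<in> filtration m \<Longrightarrow> a + b \<in> filtration m"
  unfolding filtration_def by (rule span_add)

lemma filtration_scale: "a \<in> filtration m \<Longrightarrow> s c a \<in> filtration m"
  unfolding filtration_def by (rule span_scale)

lemma filtration_diff: "a \<in> filtration m \<Longrightarrow> b \<in> filtration m \<Longrightarrow> a - b \<in> filtration m"
  unfolding filtration_def by (rule span_diff)

lemma filtration_zero: "0 \<in> filtration m"
  unfolding filtration_def by (rule span_zero)

lemma x_monomial:
  "act x (u ^ i * v ^ m) = s (\<mu> ^ i * (\<eta> * q_number lam m)) (u ^ Suc i * v ^ (m - 1))
     - s (\<mu> ^ i * (\<eta> * e * t_number m)) (u ^ i * v ^ (m - 2))"
proof -
  have "u ^ i * (u * v ^ (m - 1)) = u ^ Suc i * v ^ (m - 1)"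
    by (simp add: mult.assoc[symmetric] power_commutes)
  then show ?thesis
    by (simp add: x_u_power_mult x_v_power right_diff_distrib mult_scale scale_right_diff_distrib
        del: power_Suc)
qed

lemma x_filtration:
  assumes "a \<in> filtration m"
  shows "act x a \<in> filtration (m - 1)"
  using assms[unfolded filtration_def]
proof (induction rule: span_induct_alt)
  case base
  then show ?case by (simp add: act_zero filtration_zero)
next
  case (step c y z)
  then obtain i j where y: "y = u ^ i * v ^ j" and j: "j < m" by blast
  have "act x y \<in> filtration (m - 1)"
  proof (cases j)
    case 0
    then show ?thesis
      unfolding y 0 x_monomial by (simp add: q_number_0 t_number_def filtration_zero)
  next
    case (Suc j')
    then show ?thesis
      unfolding y x_monomial using j
      by (intro filtration_diff filtration_scale filtration_monomial) auto
  qed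
  then show ?case
    using step by (simp add: act_add act_scale filtration_add filtration_scale)
qed

lemma x_power_filtration:
  "a \<in> filtration m \<Longrightarrow> act (x ^ k) a \<in> filtration (m - k)"
proof (induction k)
  case (Suc k)
  then have "act x (act (x ^ k) a) \<in> filtration (m - k - 1)"
    by (intro x_filtration)
  then show ?case by (simp add: act_mult_left)
qed (simp add: act_one)

lemma x_leading:
  "act x (u ^ i * v ^ Suc m)
     - s (\<mu> ^ i * (\<eta> * q_number lam (Suc m))) (u ^ Suc i * v ^ m) \<in> filtration m"
proof (cases m)
  case 0
  then show ?thesis
    using x_monomial[of i "Suc 0"] by (simp add: t_number_def q_number_0 filtration_zero)
next
  case (Suc m')
  have "u ^ i * v ^ m' \<in> filtration m" using Suc by (intro filtration_monomial) simp
  then have "0 - s (\<mu> ^ i * (\<eta> * e * t_number (Suc m))) (u ^ i * v ^ m') \<in> filtration m"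
    by (intro filtration_diff filtration_scale filtration_zero)
  moreover have "act x (u ^ i * v ^ Suc m)
     - s (\<mu> ^ i * (\<eta> * q_number lam (Suc m))) (u ^ Suc i * v ^ m)
     = 0 - s (\<mu> ^ i * (\<eta> * e * t_number (Suc m))) (u ^ i * v ^ m')"
    unfolding x_monomial by (simp add: Suc del: power_Suc)
  ultimately show ?thesis by simp
qed

text \<open>Each application of x trades one v for a u and contributes a power of \<mu>, \<eta> and
  a q-number of \<lambda>. These q-numbers have indices from 1 to n - 1 because
  \<open>m < n\<close>, so the product is nonzero.\<close>

lemma x_power_leading:
  assumes "k \<le> m" "m < n"
  shows "\<exists>c. c \<noteq> 0 \<and> act (x ^ k) (u ^ i * v ^ m) - s c (u ^ (i + k) * v ^ (m - k))
           \<in> filtration (m - k)"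
  using assms
proof (induction k)
  case 0
  show ?case by (intro exI[of _ 1]) (simp add: act_one filtration_zero)
next
  case (Suc k)
  then obtain c where c: "c \<noteq> 0"
    "act (x ^ k) (u ^ i * v ^ m) - s c (u ^ (i + k) * v ^ (m - k)) \<in> filtration (m - k)"
    by auto
  obtain m' where m': "m - k = Suc m'" "m - Suc k = m'"
    using Suc.prems by (metis Suc_diff_Suc Suc_le_lessD diff_Suc_Suc)
  define d where "d = \<mu> ^ (i + k) * (\<eta> * q_number lam (Suc m'))"
  have d: "d \<noteq> 0"
  proof -
    have "\<not> n dvd Suc m'" using m' Suc.prems by (auto dest!: dvd_imp_le)
    then show ?thesis
      using q_number_eq_0[OF order_lam n_gt_1, of "Suc m'"] \<mu>_nonzero \<eta>_nonzero
      by (simp add: d_def)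
  qed
  have "act x (act (x ^ k) (u ^ i * v ^ m) - s c (u ^ (i + k) * v ^ (m - k))) \<in> filtration m'"
    using x_filtration[OF c(2)] by (simp add: m')
  moreover have "s c (act x (u ^ (i + k) * v ^ Suc m') - s d (u ^ Suc (i + k) * v ^ m')) \<in> filtration m'"
    unfolding d_def by (intro filtration_scale x_leading)
  ultimately have "act x (act (x ^ k) (u ^ i * v ^ m) - s c (u ^ (i + k) * v ^ (m - k)))
      + s c (act x (u ^ (i + k) * v ^ Suc m') - s d (u ^ Suc (i + k) * v ^ m')) \<in> filtration m'"
    by (rule filtration_add)
  then have "act (x ^ Suc k) (u ^ i * v ^ m) - s (c * d) (u ^ (i + Suc k) * v ^ m') \<in> filtration m'"
    by (simp add: act_diff act_scale act_mult_left m' scale_right_diff_distrib del: power_Suc)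
       (simp add: act_mult_left)
  then show ?case
    using c d m' by (intro exI[of _ "c * d"]) simp
qed

lemma x_power_monomial_zero: "j < m \<Longrightarrow> act (x ^ m) (u ^ i * v ^ j) = 0"
  using x_power_filtration[of "u ^ i * v ^ j" m m] by (simp add: filtration_monomial filtration_0)

text \<open>For k = m the error term lies in \<open>filtration 0\<close>, so the congruence becomes
  an equation.\<close>

lemma x_power_monomial:
  assumes "m < n"
  obtains c where "c \<noteq> 0" "act (x ^ m) (u ^ i * v ^ m) = s c (u ^ (i + m))"
  using x_power_leading[of m m i] assms by (auto simp: filtration_0)

text \<open>\<open>n\<^sup>-\<^sup>1 E\<^sub>c\<close> is the idempotent of \<open>k[g]\<close> projecting onto the \<open>\<mu>\<^sup>c\<close>-eigenspace of \<open>g\<close>.\<close>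

definition E :: "nat \<Rightarrow> 'h" where
  "E c = (\<Sum>i<n. sH ((inverse \<mu> ^ c) ^ i) (g ^ i))"

section \<open>Eigenspaces of g and a spanning family of H\<close>

lemma \<mu>_power_eq_iff:
  assumes "a < n" "b < n"
  shows "\<mu> ^ a = \<mu> ^ b \<longleftrightarrow> a = b"
proof -
  have less: "\<mu> ^ a \<noteq> \<mu> ^ b" if "a < b" "b < n" for a b
  proof
    assume "\<mu> ^ a = \<mu> ^ b"
    also have "\<mu> ^ b = \<mu> ^ a * \<mu> ^ (b - a)" using that by (simp add: power_add[symmetric])
    finally have "\<mu> ^ (b - a) = 1" using \<mu>_nonzero by simp
    then have "n dvd b - a" using has_mult_order_power_eq_1[OF order_\<mu>] by simp
    then show False using that by (auto dest!: dvd_imp_le)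
  qed
  show ?thesis
    using less[of a b] less[of b a] assms by (metis linorder_neqE_nat)
qed

lemma act_E:
  assumes "act g w = s (\<mu> ^ d) w"
  shows "act (E c) w = s (q_number (inverse \<mu> ^ c * \<mu> ^ d) n) w"
proof -
  have "act (g ^ i) w = s ((\<mu> ^ d) ^ i) w" for i
    by (induction i) (simp_all add: act_one act_mult_left act_scale assms mult.commute)
  then show ?thesis
    by (simp add: E_def act_sum_left act_scale_left q_number_def scale_sum_left
        power_mult_distrib)
qed

lemma q_number_root_of_unity:
  assumes "w ^ n = 1" "w \<noteq> 1"
  shows "q_number w n = (0::'k)"
  using q_number_mult[of w n] assms by simp

text \<open>The eigenvalue of g on the power of u turns the sum defining \<open>E\<close> into a
  geometric sum of \<mu>^(a' - a), which is n or 0.\<close>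

lemma act_E_u_power:
  assumes "a < n" "a' < n"
  shows "act (E (a + m)) (u ^ (a' + m)) = (if a = a' then s (of_nat n) (u ^ (a' + m)) else 0)"
proof -
  have "act (E (a + m)) (u ^ (a' + m))
      = s (q_number (inverse \<mu> ^ (a + m) * \<mu> ^ (a' + m)) n) (u ^ (a' + m))"
    by (rule act_E) (rule g_u_power)
  also have "inverse \<mu> ^ (a + m) * \<mu> ^ (a' + m) = inverse \<mu> ^ a * \<mu> ^ a'"
    using \<mu>_nonzero by (simp add: power_add power_inverse field_simps)
  also have "q_number (inverse \<mu> ^ a * \<mu> ^ a') n = (if a = a' then of_nat n else 0)"
  proof (cases "a = a'")
    case True
    then show ?thesis
      using \<mu>_nonzero by (simp add: q_number_def power_mult_distrib[symmetric])
  next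
    case False
    have "(inverse \<mu> ^ a * \<mu> ^ a') ^ n = 1"
      by (simp add: power_mult_distrib power_mult[symmetric] mult.commute[of _ n])
         (simp add: power_mult power_inverse \<mu>_power_n)
    moreover have "inverse \<mu> ^ a * \<mu> ^ a' \<noteq> 1"
      using False \<mu>_power_eq_iff[OF assms] \<mu>_nonzero
      by (simp add: power_inverse field_simps)
    ultimately show ?thesis using False q_number_root_of_unity by simp
  qed
  finally show ?thesis by simp
qed

text \<open>The index of \<open>E\<close> is shifted by \<open>l div n\<close> because x^b sends u^a
  v^b to a multiple of u^(a + b).\<close>

definition h :: "nat \<Rightarrow> 'h" where
  "h l = E (l mod n + l div n) * x ^ (l div n)"

lemma act_h_zero:
  assumes "l < l'" "l' < n * n"
  shows "act (h l') (r l) = 0"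
proof (cases "l div n < l' div n")
  case True
  then show ?thesis by (simp add: h_def act_mult_left r_def x_power_monomial_zero act_zero)
next
  case False
  have "l div n \<le> l' div n" using assms(1) by (simp add: div_le_mono)
  then have eq: "l div n = l' div n" using False by simp
  then have ne: "l mod n \<noteq> l' mod n" using assms(1) by (metis div_mult_mod_eq less_irrefl)
  have lt: "l' div n < n" using assms(2) by (simp add: less_mult_imp_div_less)
  obtain c where "act (x ^ (l' div n)) (u ^ (l mod n) * v ^ (l' div n)) = s c (u ^ (l mod n + l' div n))"
    using x_power_monomial[OF lt] by metis
  then show ?thesis
    using ne n_pos by (simp add: h_def r_def eq act_mult_left act_scale act_E_u_power)
qed

lemma act_h_diagonal:
  assumes "l < n * n"
  obtains c where "c \<noteq> 0" "act (h l) (r l) = s c (u ^ (l mod n + l div n))"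
proof -
  have lt: "l div n < n" using assms by (simp add: less_mult_imp_div_less)
  obtain c where c: "c \<noteq> 0"
    "act (x ^ (l div n)) (u ^ (l mod n) * v ^ (l div n)) = s c (u ^ (l mod n + l div n))"
    using x_power_monomial[OF lt] by metis
  have "act (h l) (r l) = s (c * of_nat n) (u ^ (l mod n + l div n))"
    using c(2) n_pos by (simp add: h_def r_def act_mult_left act_scale act_E_u_power)
  then show ?thesis using that[of "c * of_nat n"] c(1) n_pos by simp
qed

lemma E_mod: "E (c mod n) = E c"
proof -
  have "inverse \<mu> ^ c = inverse \<mu> ^ (n * (c div n) + c mod n)" by simp
  also have "\<dots> = inverse \<mu> ^ (c mod n)"
    unfolding power_add power_mult by (simp add: power_inverse \<mu>_power_n)
  finally show ?thesis by (simp add: E_def)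
qed

lemma E_g: "E c * g = sH (\<mu> ^ c) (E c)"
proof -
  let ?f = "\<lambda>i. sH ((inverse \<mu> ^ c) ^ i) (g ^ i)"
  \<comment> \<open>The summands are periodic in i with period n, so shifting the index only
    permutes them.\<close>
  have ends: "?f n = ?f 0"
    by (simp add: g_power_n power_mult[symmetric] mult.commute[of c n])
       (simp add: power_mult power_inverse \<mu>_power_n)
  have "sH (\<mu> ^ c) (E c) = (\<Sum>i<n. sH (\<mu> ^ c) (?f (Suc i)))"
  proof -
    have "(\<Sum>i<n. ?f (Suc i)) + ?f 0 = (\<Sum>i<n. ?f i) + ?f n"
      using sum.lessThan_Suc_shift[of ?f n] sum.lessThan_Suc[of ?f n] by (simp add: add.commute)
    then have "(\<Sum>i<n. ?f (Suc i)) = E c" unfolding ends by (simp add: E_def)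
    then show ?thesis by (simp only: HA.scale_sum_right[symmetric])
  qed
  also have "\<dots> = (\<Sum>i<n. ?f i * g)"
  proof (rule sum.cong)
    fix i
    have "\<mu> ^ c * (inverse \<mu> ^ c) ^ Suc i = (inverse \<mu> ^ c) ^ i"
      using \<mu>_nonzero by (simp add: power_inverse field_simps)
    then show "sH (\<mu> ^ c) (?f (Suc i)) = ?f i * g"
      by (simp only: HA.scale_scale HA.mult_scale power_Suc2)
  qed simp
  finally show ?thesis by (simp add: E_def sum_distrib_right)
qed

lemma sum_E: "(\<Sum>a<n. E a) = sH (of_nat n) 1"
proof -
  have "(\<Sum>a<n. E a) = (\<Sum>i<n. sH (\<Sum>a<n. (inverse \<mu> ^ a) ^ i) (g ^ i))"
    unfolding E_def HA.scale_sum_left by (rule sum.swap)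
  also have "\<dots> = (\<Sum>i<n. if i = 0 then sH (of_nat n) 1 else 0)"
  proof (rule sum.cong)
    fix i assume "i \<in> {..<n}"
    then have i: "i < n" by simp
    have "(\<Sum>a<n. (inverse \<mu> ^ a) ^ i) = q_number (inverse \<mu> ^ i) n"
      by (simp add: q_number_def power_mult[symmetric] mult.commute)
    also have "\<dots> = (if i = 0 then of_nat n else 0)"
    proof (cases "i = 0")
      case False
      have "(inverse \<mu> ^ i) ^ n = 1"
        by (simp add: power_mult[symmetric] mult.commute[of i n])
           (simp add: power_mult power_inverse \<mu>_power_n)
      moreover have "inverse \<mu> ^ i \<noteq> 1"
        using \<mu>_power_eq_iff[OF i n_pos] False \<mu>_nonzero by (simp add: power_inverse)
      ultimately show ?thesis using False q_number_root_of_unity by simp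
    qed (simp add: q_number_def)
    finally show "sH (\<Sum>a<n. (inverse \<mu> ^ a) ^ i) (g ^ i) = (if i = 0 then sH (of_nat n) 1 else 0)"
      by simp
  qed simp
  finally show ?thesis using n_pos by simp
qed

text \<open>The span contains 1, as the average of the \<open>E a\<close>, and is stable under right
  multiplication by g, which rescales each \<open>h l\<close>, and by x, which sends
  \<open>h l\<close> to another \<open>h\<close> or to 0.\<close>

lemma spanning_h: "k \<in> HA.span (h ` {..<n * n})"
  using presH
proof (induction k rule: presented_by_induct)
  case one
  have "E a \<in> HA.span (h ` {..<n * n})" if "a < n" for a
  proof -
    have "a < n * n" using that by (metis less_le_trans le_square)
    then have "h a \<in> HA.span (h ` {..<n * n})" by (intro HA.span_base) simp
    then show ?thesis using that by (simp add: h_def)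
  qed
  then have "(\<Sum>a<n. E a) \<in> HA.span (h ` {..<n * n})"
    by (intro HA.span_sum) simp
  then have "sH (inverse (of_nat n)) (sH (of_nat n) 1) \<in> HA.span (h ` {..<n * n})"
    unfolding sum_E by (rule HA.span_scale)
  then show ?case using n_pos by simp
next
  case (gen a i)
  let ?W = "HA.span (h ` {..<n * n})"
  have base: "h l * case_taft_gen g x i \<in> ?W" if l: "l < n * n" for l
  proof (cases i)
    case Gen_g
    have "h l * g = sH (lam ^ (l div n)) (E (l mod n + l div n) * g * x ^ (l div n))"
      by (simp add: h_def mult.assoc x_power_g HA.mult_scale)
    also have "\<dots> = sH (lam ^ (l div n) * \<mu> ^ (l mod n + l div n)) (h l)"
      by (simp add: E_g HA.mult_scale h_def)
    finally have eq: "h l * g = sH (lam ^ (l div n) * \<mu> ^ (l mod n + l div n)) (h l)" .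
    have "h l \<in> ?W" using l by (intro HA.span_base) simp
    then show ?thesis by (simp add: Gen_g eq HA.span_scale)
  next
    case Gen_x
    have hx: "h l * x = E (l mod n + l div n) * x ^ Suc (l div n)"
      by (simp add: h_def mult.assoc power_commutes)
    show ?thesis
    proof (cases "Suc (l div n) < n")
      case True
      \<comment> \<open>Going from x^b to x^(b + 1) raises b by one, so the residue drops by one
        cyclically to keep the index of \<open>E\<close> mod n.\<close>
      define a where "a = (l mod n + (n - 1)) mod n"
      have a: "a < n" using n_pos by (simp add: a_def)
      have "E (a + Suc (l div n)) = E (l mod n + l div n)"
      proof -
        have "(a + Suc (l div n)) mod n = (l mod n + (n - 1) + Suc (l div n)) mod n"
          unfolding a_def by (rule mod_add_left_eq)
        also have "l mod n + (n - 1) + Suc (l div n) = n + (l mod n + l div n)"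
          using n_pos by simp
        finally show ?thesis by (metis E_mod mod_add_self1)
      qed
      then have "h (Suc (l div n) * n + a) = h l * x"
        using a unfolding hx by (simp add: h_def add.commute del: mult_Suc power_Suc)
      moreover have "Suc (l div n) * n + a < n * n"
        using True a by (rule mult_add_less_mult)
      ultimately have "h l * x \<in> h ` {..<n * n}" by (metis imageI lessThan_iff)
      then show ?thesis using Gen_x by (auto intro: HA.span_base)
    next
      case False
      moreover have "l div n < n" using l by (simp add: less_mult_imp_div_less)
      ultimately have "Suc (l div n) = n" by simp
      then show ?thesis using Gen_x by (simp add: hx x_power_n HA.span_zero del: power_Suc)
    qed
  qed
  from gen show ?case
  proof (induction rule: HA.span_induct_alt)
    case (step c y z)
    then show ?case
      using base by (auto simp: distrib_right HA.mult_scale intro!: HA.span_add HA.span_scale)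
  qed (simp add: HA.span_zero)
qed (auto intro: HA.span_add HA.span_scale)

section \<open>The fixed ring\<close>

lemma fixed_by_generators:
  "act g (iota p) = iota p" "act x (iota p) = 0"
proof -
  \<comment> \<open>The elements fixed by g and killed by x form a subalgebra; it contains u^n and
    v^n, which generate R.\<close>
  define fixed where "fixed = {a. act g a = a \<and> act x a = 0}"
  have add: "a + b \<in> fixed" and mult: "a * b \<in> fixed" if "a \<in> fixed" "b \<in> fixed" for a b
    using that by (simp_all add: fixed_def act_add act_g_mult act_x_mult)
  have sc: "s c 1 \<in> fixed" for c
    by (simp add: fixed_def act_scale act_g_one act_x_one)
  have zero: "0 \<in> fixed" by (simp add: fixed_def act_zero)
  have un: "u ^ n \<in> fixed"
    using x_u_power_mult[of n 1] by (simp add: fixed_def g_u_power \<mu>_power_n act_x_one)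
  have vn: "v ^ n \<in> fixed"
    using order_lam by (simp add: fixed_def g_v_power x_v_power_n power_mult_distrib \<mu>_power_n
        has_mult_order_def)
  have "iota0 q \<in> fixed" for q
    by (induction q) (simp_all add: inner.ev_zero inner.ev_pCons zero add mult sc vn)
  then have "iota p \<in> fixed"
    by (induction p) (simp_all add: iota_zero iota_pCons zero add mult un)
  then show "act g (iota p) = iota p" "act x (iota p) = 0" by (simp_all add: fixed_def)
qed

lemma act_iota_mult: "act k (iota p * a) = iota p * act k a"
proof -
  have "\<forall>a. act k (iota p * a) = iota p * act k a"
    using presH
  proof (induction k rule: presented_by_induct)
    case (gen k i)
    show ?case
      by (cases i) (simp_all add: act_mult_left act_g_mult act_x_mult fixed_by_generators gen)
  qed (simp_all add: act_one act_add_left act_scale_left distrib_left mult_scale)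
  then show ?thesis by blast
qed

lemma iota_left_commute: "a * (iota p * b) = iota p * (a * b)"
  by (metis iota_central mult.assoc)

text \<open>A further power of u completes u^m to a power of the central u^n, and A is free over the
  domain R.\<close>

lemma u_power_cancel:
  assumes "a * u ^ m = 0"
  shows "a = 0"
proof -
  have "u ^ m * u ^ (n * m - m) = (u ^ n) ^ m"
    using n_pos by (simp add: power_add[symmetric] power_mult[symmetric])
  then have "a * (u ^ n) ^ m = 0"
    using assms by (metis mult.assoc mult_zero_left)
  then have "iota ([:0, 1:] ^ m) * a = 0"
    by (subst iota_central) (simp only: iota_power iota_U)
  then have "[:0, 1:] ^ m * coordA a l = 0" if "l < n * n" for l
    using coordA_iota[OF that, of "[:0, 1:] ^ m" a] coordA_zero[OF that] by simp
  then have "coordA a l = 0" if "l < n * n" for l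
    using that by (metis mult_eq_0_iff pCons_eq_0_iff pCons_eq_iff power_not_zero zero_neq_one)
  then show ?thesis
    by (subst coordA_sum) (simp add: iota_zero)
qed

text \<open>Every \<open>h\<^sub>l\<close> with \<open>l > 0\<close> annihilates the invariants. By triangularity this kills the
  coordinates of an invariant one by one, from the largest index down to \<open>l = 1\<close>.\<close>

lemma invariants_eq: "invariants H s act = range iota"
proof
  show "range iota \<subseteq> invariants H s act"
  proof clarify
    fix p
    show "iota p \<in> invariants H s act"
      using act_iota_mult[of _ p 1] by (simp add: invariants_def act_unit mult_scale)
  qed
next
  show "invariants H s act \<subseteq> range iota"
  proof
    fix a assume "a \<in> invariants H s act"
    then have inv: "act g a = a" "act x a = 0"
      using taft by (simp_all add: invariants_def taft_algebra_def)
    \<comment> \<open>For b = 0 the element is \<open>E l\<close>, belonging to an eigenvalue other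
      than 1; for b > 0 the rightmost x already kills the invariant.\<close>
    have hinv: "act (h l) a = 0" if l: "l < n * n" "0 < l" for l
    proof (cases "l div n")
      case 0
      then have ln: "l < n" using n_pos by (simp add: div_eq_0_iff)
      have "act (E l) a = s (q_number (inverse \<mu> ^ l * \<mu> ^ 0) n) a"
        by (rule act_E) (simp add: inv)
      also have "q_number (inverse \<mu> ^ l * \<mu> ^ 0) n = 0"
      proof (rule q_number_root_of_unity)
        show "(inverse \<mu> ^ l * \<mu> ^ 0) ^ n = 1"
          by (simp add: power_mult[symmetric] mult.commute[of l n])
             (simp add: power_mult power_inverse \<mu>_power_n)
        show "inverse \<mu> ^ l * \<mu> ^ 0 \<noteq> 1"
          using \<mu>_power_eq_iff[OF ln n_pos] l \<mu>_nonzero by (simp add: power_inverse)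
      qed
      finally show ?thesis using ln by (simp add: h_def act_one)
    next
      case (Suc b)
      then show ?thesis
        by (simp add: h_def act_mult_left power_Suc2 inv act_zero del: power_Suc)
    qed
    have "coordA a l = 0" if "0 < l" "l < n * n" for l
      using that
    proof (induction "n * n - l" arbitrary: l rule: less_induct)
      case less
      have higher: "coordA a l' = 0" if "l < l'" "l' < n * n" for l'
        using less.hyps[of l'] less.prems that by simp
      have "0 = act (h l) a" using hinv less.prems by simp
      also have "\<dots> = (\<Sum>l'<n * n. iota (coordA a l') * act (h l) (r l'))"
        by (subst coordA_sum) (simp add: act_sum act_iota_mult)
      also have "\<dots> = (\<Sum>l'<n * n. if l' = l then iota (coordA a l) * act (h l) (r l) else 0)"
      proof (rule sum.cong)
        fix l' assume "l' \<in> {..<n * n}"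
        then show "iota (coordA a l') * act (h l) (r l')
            = (if l' = l then iota (coordA a l) * act (h l) (r l) else 0)"
          using less.prems higher[of l'] act_h_zero[of l' l]
          by (cases l l' rule: linorder_cases) (simp_all add: iota_zero)
      qed simp
      also have "\<dots> = iota (coordA a l) * act (h l) (r l)" using less.prems by simp
      finally have 0: "iota (coordA a l) * act (h l) (r l) = 0" by simp
      obtain c where c: "c \<noteq> 0" "act (h l) (r l) = s c (u ^ (l mod n + l div n))"
        using act_h_diagonal less.prems by blast
      then have "s c (iota (coordA a l)) * u ^ (l mod n + l div n) = 0"
        using 0 by (simp add: mult_scale)
      then have "s c (iota (coordA a l)) = 0" by (rule u_power_cancel)
      then have "iota (coordA a l) = iota 0" using c(1) by (simp add: iota_zero)
      then show ?case by (rule iota_inj)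
    qed
    then have "(\<Sum>l<n * n. iota (coordA a l) * r l) = (\<Sum>l<n * n. if l = 0 then iota (coordA a 0) else 0)"
      by (intro sum.cong) (auto simp: iota_zero r_def)
    then have "a = iota (coordA a 0)"
      using n_pos coordA_sum[of a] by simp
    then show "a \<in> range iota" by blast
  qed
qed

end

section \<open>The smash product as an algebra of matrices over the center\<close>

locale taft_smash = taft_action s u v \<mu> e n lam \<eta> H g x act
  for s :: "'k::field_char_0 \<Rightarrow> 'a::ring_1 \<Rightarrow> 'a" and u v \<mu> e n lam \<eta>
    and H :: "('k, 'h::ring_1, 't::ring_1) hopf" and g x act +
  fixes sB :: "'k \<Rightarrow> 'b::ring_1 \<Rightarrow> 'b" and sm :: "'a \<Rightarrow> 'h \<Rightarrow> 'b"
  assumes smash: "smash_product H s act sB sm"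
begin

sublocale BA: k_algebra sB
  using smash by (simp add: smash_product_def)

sublocale BT: tensor_product s sH sB sm
  using smash by unfold_locales (simp add: smash_product_def)

lemma sm_one: "sm 1 1 = 1"
  using smash by (simp add: smash_product_def)

lemma sm_mult:
  "sweedler H k p \<Longrightarrow> sm a k * sm a' k' = lin_ext sB (\<lambda>(h1, h2). sm (a * act h1 a') (h2 * k')) p"
  using smash unfolding smash_product_def by blast

lemma sweedler_exists: obtains p where "sweedler H k p"
  using HT.tensor unfolding is_tensor_product_def sweedler_def surj_def by metis

lemma sm_one_mult: "sm a 1 * sm a' k' = sm (a * a') k'"
proof -
  have "sweedler H 1 (Poly_Mapping.single (1, 1) 1)"
    using taft by (simp add: sweedler_def HT.lin_ext_single taft_algebra_def tensor_square_def
        algebra_hom_def)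
  then show ?thesis by (simp add: sm_mult BA.lin_ext_single act_one)
qed

section \<open>The representation of the smash product on A\<close>

definition \<Phi> :: "'b \<Rightarrow> 'a \<Rightarrow> 'a" where
  "\<Phi> b a = (SOME f. \<forall>p. f (BT.tensor_eval p) = lin_ext s (\<lambda>(r, k). r * act k a) p) b"

text \<open>r # k acts by a \<mapsto> r (k a). This is bilinear in r and k, so the universal
  property supplies the map that \<open>SOME\<close> selects.\<close>

lemma \<Phi>_tensor_eval: "\<Phi> (BT.tensor_eval p) a = lin_ext s (\<lambda>(r, k). r * act k a) p"
proof -
  have "\<exists>f. \<forall>p. f (BT.tensor_eval p) = lin_ext s (\<lambda>(r, k). r * act k a) p"
  proof (rule BT.tensor_lift[OF vector_space_axioms, where \<beta> = "\<lambda>r k. r * act k a"])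
    fix f :: "'b \<Rightarrow> 'a"
    assume "\<And>p. f (BT.tensor_eval p) = lin_ext s (\<lambda>(r, k). r * act k a) p"
    then show "\<exists>f. \<forall>p. f (BT.tensor_eval p) = lin_ext s (\<lambda>(r, k). r * act k a) p" by blast
  qed (simp_all add: distrib_left distrib_right act_add_left act_scale_left mult_scale)
  from someI_ex[OF this] show ?thesis by (simp add: \<Phi>_def)
qed

lemma tensor_eval_surj: obtains p where "b = BT.tensor_eval p"
  using BT.tensor by (auto simp: is_tensor_product_def)

lemma \<Phi>_sm: "\<Phi> (sm a k) a' = a * act k a'"
  using \<Phi>_tensor_eval[of "Poly_Mapping.single (a, k) 1" a']
  by (simp add: BA.lin_ext_single lin_ext_single)

lemma \<Phi>_add_left: "\<Phi> (b + b') a = \<Phi> b a + \<Phi> b' a"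
proof -
  obtain p q where "b = BT.tensor_eval p" "b' = BT.tensor_eval q"
    by (metis tensor_eval_surj)
  then show ?thesis
    by (simp only: BA.lin_ext_add[symmetric] \<Phi>_tensor_eval lin_ext_add)
qed

lemma \<Phi>_scale_left: "\<Phi> (sB c b) a = s c (\<Phi> b a)"
proof -
  obtain p where "b = BT.tensor_eval p"
    by (metis tensor_eval_surj)
  then show ?thesis
    by (simp only: BA.lin_ext_map[symmetric] \<Phi>_tensor_eval lin_ext_map)
qed

lemma \<Phi>_add: "\<Phi> b (a + a') = \<Phi> b a + \<Phi> b a'"
  by (induction b rule: BT.tensor_induct)
     (simp_all add: \<Phi>_sm \<Phi>_add_left act_add distrib_left)

lemma \<Phi>_iota: "\<Phi> b (iota p * a) = iota p * \<Phi> b a"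
proof (induction b rule: BT.tensor_induct)
  case (tensor a' k)
  show ?case by (simp add: \<Phi>_sm act_iota_mult iota_left_commute)
qed (simp add: \<Phi>_add_left distrib_left)

lemma \<Phi>_zero: "\<Phi> b 0 = 0"
  using \<Phi>_iota[of b 0 0] by (simp add: iota_zero)

lemma \<Phi>_sum: "\<Phi> b (sum f S) = (\<Sum>i\<in>S. \<Phi> b (f i))"
  by (induction S rule: infinite_finite_induct) (simp_all add: \<Phi>_zero \<Phi>_add)

lemma \<Phi>_lin_ext: "\<Phi> (lin_ext sB f p) a = lin_ext s (\<lambda>i. \<Phi> (f i) a) p"
proof (induction p rule: poly_mapping_additive_induct)
  case (single i c)
  show ?case by (simp add: BA.lin_ext_single lin_ext_single \<Phi>_scale_left)
qed (simp add: BA.lin_ext_add lin_ext_add \<Phi>_add_left)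

lemma mult_lin_ext: "a * lin_ext s f p = lin_ext s (\<lambda>i. a * f i) p"
  by (simp add: lin_ext_def sum_distrib_left mult_scale)

text \<open>One Sweedler expansion of \<open>k\<close> serves both the smash multiplication and the
  rule for acting on a product, and the two then agree.\<close>

lemma \<Phi>_mult: "\<Phi> (b * b') a = \<Phi> b (\<Phi> b' a)"
proof (induction b rule: BT.tensor_induct)
  case (tensor c k)
  show ?case
  proof (induction b' rule: BT.tensor_induct)
    case (tensor c' k')
    obtain p where p: "sweedler H k p" by (rule sweedler_exists)
    have "\<Phi> (sm c k * sm c' k') a
        = lin_ext s (\<lambda>i. \<Phi> (case i of (h1, h2) \<Rightarrow> sm (c * act h1 c') (h2 * k')) a) p"
      by (simp only: sm_mult[OF p] \<Phi>_lin_ext)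
    also have "\<dots> = lin_ext s (\<lambda>i. c * (case i of (h1, h2) \<Rightarrow> act h1 c' * act h2 (act k' a))) p"
      by (intro arg_cong2[of _ _ _ _ "lin_ext s"] ext)
         (auto simp: \<Phi>_sm act_mult_left mult.assoc)
    also have "\<dots> = c * act k (c' * act k' a)"
      by (simp only: mult_lin_ext[symmetric] act_sweedler[OF p])
    finally show ?case by (simp add: \<Phi>_sm)
  qed (simp add: distrib_left \<Phi>_add_left \<Phi>_add)
qed (simp add: distrib_right \<Phi>_add_left)

abbreviation N :: nat where "N \<equiv> n * n"

definition j :: "'k poly poly \<Rightarrow> 'b" where
  "j p = sm (iota p) 1"

definition \<Psi> :: "'b \<Rightarrow> 'k poly poly mat" where
  "\<Psi> b = mat N N (\<lambda>(k, l). coordA (\<Phi> b (r l)) k)"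

lemma \<Phi>_j: "\<Phi> (j p * b) a = iota p * \<Phi> b a"
  by (simp add: \<Phi>_mult j_def \<Phi>_sm act_one)

lemma \<Psi>_mult: "\<Psi> (b * b') = \<Psi> b * \<Psi> b'"
proof (rule eq_matI)
  fix k l assume "k < dim_row (\<Psi> b * \<Psi> b')" "l < dim_col (\<Psi> b * \<Psi> b')"
  then have kl: "k < N" "l < N" by (simp_all add: \<Psi>_def)
  have "\<Phi> b (\<Phi> b' (r l)) = (\<Sum>i<N. iota (coordA (\<Phi> b' (r l)) i) * \<Phi> b (r i))"
    by (subst coordA_sum[of "\<Phi> b' (r l)"]) (simp add: \<Phi>_sum \<Phi>_iota)
  then have "coordA (\<Phi> (b * b') (r l)) k
      = (\<Sum>i<N. coordA (\<Phi> b' (r l)) i * coordA (\<Phi> b (r i)) k)"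
    using kl by (simp add: \<Phi>_mult coordA_sum_fun coordA_iota)
  then show "\<Psi> (b * b') $$ (k, l) = (\<Psi> b * \<Psi> b') $$ (k, l)"
    using kl by (simp add: \<Psi>_def scalar_prod_def atLeast0LessThan mult.commute)
qed (simp_all add: \<Psi>_def)

sublocale MR: matrix_representation j \<Psi> N
proof
  show "j 1 = 1" by (simp add: j_def iota_one sm_one)
  show "j (p + q) = j p + j q" for p q by (simp add: j_def iota_add BT.tensor_add_left)
  show "j (p * q) = j p * j q" for p q by (simp add: j_def iota_mult sm_one_mult)
  show "inj j"
  proof (rule injI)
    fix p q assume "j p = j q"
    then have "\<Phi> (j p) 1 = \<Phi> (j q) 1" by simp
    then show "p = q" by (simp add: j_def \<Phi>_sm act_one iota_inj)
  qed
  show "\<Psi> b \<in> carrier_mat N N" for b by (simp add: \<Psi>_def)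
  show "\<Psi> (b + b') = \<Psi> b + \<Psi> b'" for b b'
    by (rule eq_matI) (simp_all add: \<Psi>_def \<Phi>_add_left coordA_add)
  show "\<Psi> (b * b') = \<Psi> b * \<Psi> b'" for b b' by (rule \<Psi>_mult)
  show "\<Psi> (j p * b) = p \<cdot>\<^sub>m \<Psi> b" for p b
    by (rule eq_matI) (simp_all add: \<Psi>_def \<Phi>_j coordA_iota)
  show "(of_nat N :: 'k poly poly) \<noteq> 0"
    using n_pos by (simp only: of_nat_eq_0_iff) simp
qed

section \<open>A basis of the smash product over R\<close>

definition y :: "nat \<Rightarrow> 'b" where
  "y t = sm (r (t mod N)) (h (t div N))"

lemma spanning_y: "MR.spanning (N * N) y"
  unfolding MR.spanning_def
proof
  fix b
  let ?P = "\<lambda>b. \<exists>c. b = (\<Sum>t<N * N. j (c t) * y t)"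
  have add: "?P (b + b')" if b: "?P b" and b': "?P b'" for b b'
  proof -
    obtain c c' where "b = (\<Sum>t<N * N. j (c t) * y t)" "b' = (\<Sum>t<N * N. j (c' t) * y t)"
      using b b' by blast
    then have "b + b' = (\<Sum>t<N * N. j (c t + c' t) * y t)"
      by (simp add: MR.j_add distrib_right sum.distrib)
    then show ?thesis by (rule exI[of _ "\<lambda>t. c t + c' t"])
  qed
  show "?P b"
  proof (induction b rule: BT.tensor_induct)
    case (tensor a k)
    show ?case
      using spanning_h[of k]
    proof (induction rule: HA.span_induct_alt)
      case base
      have "sm a 0 = (\<Sum>t<N * N. j 0 * y t)"
        using BT.tensor_scale_right[of a 0 0] by (simp add: MR.j_zero)
      then show ?case by (rule exI[of _ "\<lambda>_. 0"])
    next
      case (step d k' k)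
      then obtain l where l: "k' = h l" "l < N" by blast
      \<comment> \<open>The scalar \<open>d\<close> is moved to the left factor, and the expansion
        of \<open>s d a\<close> is placed in the block belonging to \<open>h l\<close>.\<close>
      let ?c = "\<lambda>t. if t div N = l then coordA (s d a) (t mod N) else 0"
      have "(\<Sum>t<N * N. j (?c t) * y t)
          = (\<Sum>l'<N. \<Sum>i<N. j (if l' = l then coordA (s d a) i else 0) * sm (r i) (h l'))"
        unfolding y_def by (rule sum_div_mod)
      also have "\<dots> = (\<Sum>l'<N. if l' = l then (\<Sum>i<N. j (coordA (s d a) i) * sm (r i) (h l)) else 0)"
        by (intro sum.cong) (auto simp: MR.j_zero)
      also have "\<dots> = (\<Sum>i<N. sm (iota (coordA (s d a) i) * r i) (h l))"
        using l(2) by (simp add: j_def sm_one_mult)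
      also have "\<dots> = sm (\<Sum>i<N. iota (coordA (s d a) i) * r i) (h l)"
      proof -
        have "sm (sum f S) k = (\<Sum>i\<in>S. sm (f i) k)" for f and S :: "nat set" and k
        proof (induction S rule: infinite_finite_induct)
          case empty
          show ?case using BT.tensor_scale_left[of 0 0 k] by simp
        next
          case (infinite S)
          then show ?case using BT.tensor_scale_left[of 0 0 k] by simp
        qed (simp add: BT.tensor_add_left)
        then show ?thesis by simp
      qed
      also have "\<dots> = sm a (sH d k')"
        by (simp add: coordA_sum[symmetric] l BT.tensor_scale_left BT.tensor_scale_right)
      finally have "?P (sm a (sH d k'))" by (intro exI[of _ ?c]) simp
      then have "?P (sm a (sH d k') + sm a k)" using step.IH by (rule add)
      then show ?case by (simp only: BT.tensor_add_right)
    qed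
  qed (rule add)
qed

section \<open>Right multiplications and the determinant of P\<close>

definition \<rho> :: "'a \<Rightarrow> 'k poly poly mat" where
  "\<rho> w = mat N N (\<lambda>(k, l). coordA (r l * w) k)"

lemma \<rho>_carrier: "\<rho> w \<in> carrier_mat N N"
  by (simp add: \<rho>_def)

text \<open>Right multiplication reverses products; determinants do not see the order.\<close>

lemma \<rho>_mult: "\<rho> (w * w') = \<rho> w' * \<rho> w"
proof (rule eq_matI)
  fix k l assume "k < dim_row (\<rho> w' * \<rho> w)" "l < dim_col (\<rho> w' * \<rho> w)"
  then have kl: "k < N" "l < N" by (simp_all add: \<rho>_def)
  have "r l * (w * w') = (\<Sum>i<N. iota (coordA (r l * w) i) * r i) * w'"
    by (simp add: coordA_sum[symmetric] mult.assoc)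
  also have "\<dots> = (\<Sum>i<N. iota (coordA (r l * w) i) * (r i * w'))"
    by (simp add: sum_distrib_right mult.assoc)
  finally have "coordA (r l * (w * w')) k
      = (\<Sum>i<N. coordA (r l * w) i * coordA (r i * w') k)"
    using kl by (simp only: coordA_sum_fun coordA_iota)
  then show "\<rho> (w * w') $$ (k, l) = (\<rho> w' * \<rho> w) $$ (k, l)"
    using kl by (simp add: \<rho>_def scalar_prod_def atLeast0LessThan mult.commute)
qed (simp_all add: \<rho>_def)

lemma \<rho>_iota_mult: "\<rho> (iota p * w) = p \<cdot>\<^sub>m \<rho> w"
  by (rule eq_matI) (simp_all add: \<rho>_def coordA_iota iota_left_commute)

lemma \<rho>_one: "\<rho> 1 = 1\<^sub>m N"
  by (rule eq_matI) (simp_all add: \<rho>_def coordA_r)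

lemma \<rho>_zero: "\<rho> 0 = 0\<^sub>m N N"
  by (rule eq_matI) (simp_all add: \<rho>_def coordA_zero)

lemma det_\<rho>_power: "det (\<rho> (w ^ m)) = det (\<rho> w) ^ m"
proof (induction m)
  case (Suc m)
  then show ?case
    by (simp add: \<rho>_mult det_mult[OF \<rho>_carrier \<rho>_carrier] mult.commute)
qed (simp add: \<rho>_one)

lemma det_\<rho>_scale: "det (\<rho> (s c w)) = [:[:c:]:] ^ N * det (\<rho> w)"
proof -
  have "s c w = iota [:[:c:]:] * w" by (simp add: iota_scalar mult_scale)
  then show ?thesis using \<rho>_carrier[of w] by (simp add: \<rho>_iota_mult)
qed

lemma det_\<rho>_u: "det (\<rho> u) ^ n = [:0, 1:] ^ N"
proof -
  have "det (\<rho> u) ^ n = det (\<rho> (iota [:0, 1:] * 1))"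
    by (simp add: det_\<rho>_power[symmetric] iota_U)
  also have "\<dots> = [:0, 1:] ^ N"
    unfolding \<rho>_iota_mult \<rho>_one by simp
  finally show ?thesis .
qed

lemma const_power: "[:[:c:]:] ^ m = [:[:c ^ m:]:]" for c :: 'k
  by (induction m) (simp_all add: one_pCons)

lemma const_prod: "(\<Prod>l\<in>S. [:[:f l:]:]) = [:[:\<Prod>l\<in>S. f l:]:]" for f :: "nat \<Rightarrow> 'k"
  by (induction S rule: infinite_finite_induct) (simp_all add: one_pCons)

lemma sum_degrees: "(\<Sum>l<N. l mod n + l div n) = n * (n * (n - 1))"
proof -
  have "(\<Sum>l<N. l mod n + l div n) = (\<Sum>b<n. \<Sum>a<n. a + b)"
    using sum_div_mod[of "\<lambda>b a. a + b" n n] by simp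
  also have "\<dots> = n * (\<Sum>a<n. a) + n * (\<Sum>b<n. b)"
    by (simp add: sum.distrib sum_distrib_left)
  also have "2 * (n * (\<Sum>a<n. a) + n * (\<Sum>b<n. b)) = 2 * (n * (n * (n - 1)))"
  proof -
    have "2 * (\<Sum>a<m. a) = m * (m - 1)" for m :: nat
    proof (induction m)
      case (Suc m)
      then show ?case by (cases m) (simp_all add: algebra_simps)
    qed simp
    then show ?thesis by (simp add: algebra_simps)
  qed
  finally show ?thesis by simp
qed

lemma det_flat_mat_y:
  obtains \<kappa> where "\<kappa> \<noteq> 0"
    "det (MR.flat_mat (N * N) y) = [:[:\<kappa>:]:] * [:0, 1:] ^ (n ^ 3 * (n - 1))"
proof -
  define W where "W l l' = \<rho> (act (h l') (r l))" for l l'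
  \<comment> \<open>As r' # h' sends r to r' (h' r), varying r' gives the matrix of right
    multiplication by h' r; this is one block.\<close>
  have "MR.flat_mat (N * N) y
      = mat (N * N) (N * N) (\<lambda>(i, t). W (i div N) (t div N) $$ (i mod N, t mod N))"
  proof (rule eq_matI)
    fix i t
    assume "i < dim_row (mat (N * N) (N * N) (\<lambda>(i, t). W (i div N) (t div N) $$ (i mod N, t mod N)))"
      "t < dim_col (mat (N * N) (N * N) (\<lambda>(i, t). W (i div N) (t div N) $$ (i mod N, t mod N)))"
    then have it: "i < N * N" "t < N * N" by auto
    note it' = MR.index_less[OF it(1)] MR.index_less[OF it(2)]
    show "MR.flat_mat (N * N) y $$ (i, t)
        = mat (N * N) (N * N) (\<lambda>(i, t). W (i div N) (t div N) $$ (i mod N, t mod N)) $$ (i, t)"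
      using it it' by (simp add: MR.flat_mat_def MR.flat_def \<Psi>_def y_def \<Phi>_sm W_def \<rho>_def)
  qed (simp_all add: MR.flat_mat_def)
  then have "det (MR.flat_mat (N * N) y) = (\<Prod>l<N. det (W l l))"
    by (simp only:) (rule det_block_triangular, simp_all add: W_def \<rho>_carrier act_h_zero \<rho>_zero)
  moreover have "\<exists>c. c \<noteq> 0 \<and> act (h l) (r l) = s c (u ^ (l mod n + l div n))" if "l < N" for l
    using act_h_diagonal[OF that] by metis
  then obtain c where c: "\<And>l. l < N \<Longrightarrow> c l \<noteq> 0"
    "\<And>l. l < N \<Longrightarrow> act (h l) (r l) = s (c l) (u ^ (l mod n + l div n))"
    by metis
  have "(\<Prod>l<N. det (W l l)) = (\<Prod>l<N. [:[:c l ^ N:]:] * det (\<rho> u) ^ (l mod n + l div n))"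
    by (intro prod.cong) (simp_all add: W_def c(2) det_\<rho>_scale det_\<rho>_power const_power)
  also have "\<dots> = [:[:\<Prod>l<N. c l ^ N:]:] * det (\<rho> u) ^ (n * (n * (n - 1)))"
    by (simp only: prod.distrib const_prod power_sum[symmetric] sum_degrees)
  \<comment> \<open>The n^2 (n - 1) factors are grouped by n, and each group gives the N-th power of
    the variable for u^n.\<close>
  also have "det (\<rho> u) ^ (n * (n * (n - 1))) = [:0, 1:] ^ (n ^ 3 * (n - 1))"
  proof -
    have "det (\<rho> u) ^ (n * (n * (n - 1))) = (det (\<rho> u) ^ n) ^ (n * (n - 1))"
      by (rule power_mult)
    also have "\<dots> = [:0, 1:] ^ (N * (n * (n - 1)))"
      unfolding det_\<rho>_u by (rule power_mult[symmetric])
    also have "N * (n * (n - 1)) = n ^ 3 * (n - 1)"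
      by (simp add: power3_eq_cube)
    finally show ?thesis .
  qed
  ultimately show ?thesis
    using that[of "\<Prod>l<N. c l ^ N"] c(1) by simp
qed

lemma det_flat_mat_y_nonzero: "det (MR.flat_mat (N * N) y) \<noteq> 0"
proof -
  obtain \<kappa> where "\<kappa> \<noteq> 0"
    "det (MR.flat_mat (N * N) y) = [:[:\<kappa>:]:] * [:0, 1:] ^ (n ^ 3 * (n - 1))"
    by (rule det_flat_mat_y)
  then show ?thesis by simp
qed

section \<open>Faithfulness, centrality and the discriminant\<close>

lemma \<Phi>_faithful:
  assumes "\<And>a. \<Phi> b a = 0"
  shows "b = 0"
proof -
  obtain c where c: "b = (\<Sum>t<N * N. j (c t) * y t)"
    using spanning_y unfolding MR.spanning_def by blast
  have "MR.flat b i = 0" if "i < N * N" for i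
    using MR.index_less[OF that] by (simp add: MR.flat_def \<Psi>_def assms coordA_zero)
  then have "c t = 0" if "t < N * N" for t
    using MR.coefficient_zero_if_flat_zero[OF det_flat_mat_y_nonzero _ that] unfolding c by blast
  then show ?thesis unfolding c by (simp add: MR.j_zero)
qed

text \<open>The action on A is R-linear, so commutators with R act as zero, and the action is
  faithful.\<close>

lemma j_central: "j p * b = b * j p"
proof -
  have "\<Phi> (j p * b - b * j p) a = 0" for a
  proof -
    have "\<Phi> (j p * b) a = \<Phi> (b * j p) a"
      unfolding \<Phi>_j by (simp add: \<Phi>_mult j_def \<Phi>_sm act_one \<Phi>_iota)
    then show ?thesis
      using \<Phi>_add_left[of "j p * b - b * j p" "b * j p" a] by simp
  qed
  then have "j p * b - b * j p = 0" by (rule \<Phi>_faithful)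
  then show ?thesis by simp
qed

lemma smash_invariants_eq: "smash_invariants H s act sm = range j"
  by (simp add: smash_invariants_def invariants_eq image_image j_def)

lemma j_scalar: "j [:[:c:]:] * b = sB c b"
  by (simp add: j_def iota_scalar BT.tensor_scale_left sm_one BA.mult_scale)

lemma central_subalgebra_j: "central_subalgebra sB (range j)"
  unfolding central_subalgebra_def
proof (intro conjI ballI allI)
  have "sB c (j p) \<in> range j" for c p
    by (simp only: j_scalar[symmetric] MR.j_mult[symmetric]) simp
  then show "BA.subspace (range j)"
    by (intro BA.subspaceI) (auto simp: MR.j_add[symmetric] MR.j_zero[symmetric])
  show "1 \<in> range j" by (rule range_eqI[of _ _ 1]) (simp add: MR.j_one)
  show "a * b \<in> range j" if "a \<in> range j" "b \<in> range j" for a b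
    using that by (auto simp: MR.j_mult[symmetric])
  show "a * b = b * a" if "a \<in> range j" for a b
    using that by (auto simp: j_central)
qed

text \<open>Units of a polynomial ring over a domain are constant. Applied twice, this turns
  equality up to units of R into equality up to scalars.\<close>

lemma is_unit_const:
  fixes p :: "'k poly poly"
  assumes "p dvd 1"
  obtains c where "c \<noteq> 0" "p = [:[:c:]:]"
proof -
  obtain q where q: "p = [:q:]" "q dvd 1" using assms by (auto simp: is_unit_poly_iff)
  then obtain c where "q = [:c:]" "c dvd 1" by (auto simp: is_unit_poly_iff)
  then show ?thesis using that[of c] q by (cases "c = 0") simp_all
qed

text \<open>Squaring det P doubles the exponent n^3 (n - 1), and replacing the outer variable by u^n
  multiplies it by n.\<close>

theorem discriminant_smash:
  assumes "is_free_basis (range j) \<omega> z"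
  shows "eq_up_to_scalar sB (discriminant (range j) \<omega> z) (sm (u ^ (2 * n ^ 4 * (n - 1))) 1)"
proof -
  obtain \<kappa> where \<kappa>: "\<kappa> \<noteq> 0"
    "det (MR.flat_mat (N * N) y) = [:[:\<kappa>:]:] * [:0, 1:] ^ (n ^ 3 * (n - 1))"
    by (rule det_flat_mat_y)
  obtain \<epsilon> where "\<epsilon> dvd 1" and disc: "discriminant (range j) \<omega> z
      = j (of_nat N ^ (N * N) * \<epsilon> * det (MR.flat_mat (N * N) y) ^ 2)"
    using MR.discriminant_eq[OF spanning_y det_flat_mat_y_nonzero assms] by metis
  then obtain c where c: "c \<noteq> 0" "\<epsilon> = [:[:c:]:]" using is_unit_const by blast
  \<comment> \<open>Collects the trace factor N, the unit from the change of basis and the scalar of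
    det P; it is nonzero in characteristic zero.\<close>
  let ?c = "of_nat N ^ (N * N) * c * \<kappa> ^ 2"
  have ofn: "of_nat m = [:[:of_nat m :: 'k:]:]" for m
    by (induction m) (simp_all add: one_pCons)
  have "of_nat N ^ (N * N) * \<epsilon> * det (MR.flat_mat (N * N) y) ^ 2
      = [:[:?c:]:] * [:0, 1:] ^ (n ^ 3 * (n - 1) * 2)"
    unfolding \<kappa>(2) c(2) ofn power_mult_distrib const_power power_mult by simp
  then have "discriminant (range j) \<omega> z = sB ?c (j ([:0, 1:] ^ (n ^ 3 * (n - 1) * 2)))"
    unfolding disc by (simp only: MR.j_mult j_scalar)
  also have "j ([:0, 1:] ^ (n ^ 3 * (n - 1) * 2)) = sm (u ^ (n * (n ^ 3 * (n - 1) * 2))) 1"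
    by (simp only: j_def iota_power iota_U power_mult)
  also have "n * (n ^ 3 * (n - 1) * 2) = 2 * n ^ 4 * (n - 1)"
    by (simp add: power_numeral_reduce)
  finally show ?thesis
    using c(1) \<kappa>(1) n_pos unfolding eq_up_to_scalar_def by (intro exI[of _ ?c]) simp
qed

lemma free_basis_y: "is_free_basis (range j) (N * N) y"
  using MR.is_free_basis_iff spanning_y MR.independent_if_det_nonzero[OF det_flat_mat_y_nonzero]
  by blast

end

text \<open>Centrality and the existence of a basis are part of the conclusion, so that the
  discriminant is defined and the claim about all bases is not vacuous.\<close>

theorem theorem2:
  fixes n :: nat
    and lam \<mu> \<eta> :: "'k::{alg_closed_field, field_char_0}"
    and H :: "('k, 'h::ring_1, 't::ring_1) hopf" and g x :: 'h
    and sA :: "'k \<Rightarrow> 'a::ring_1 \<Rightarrow> 'a" and u v :: 'a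
    and act :: "'h \<Rightarrow> 'a \<Rightarrow> 'a"
    and sB :: "'k \<Rightarrow> 'b::ring_1 \<Rightarrow> 'b" and sm :: "'a \<Rightarrow> 'h \<Rightarrow> 'b"
  assumes "n > 1"
    and "has_mult_order lam n"
    and "\<mu> \<noteq> 0" and "has_mult_order \<mu> n"
    and "taft_algebra n lam H g x"
    and "quantum_plane \<mu> sA u v \<or>
         quantum_weyl_algebra \<mu> sA u v \<and> lam = inverse (\<mu> ^ 2)"
    and "hopf_action H sA act"
    and "linear_action sA u v g x act"
    and "inner_faithful H act"
    and "act g u = sA \<mu> u" and "act g v = sA (lam * \<mu>) v"
    and "act x u = 0" and "\<eta> \<noteq> 0" and "act x v = sA \<eta> u"
    and "smash_product H sA act sB sm"
  shows "let AH = smash_invariants H sA act sm in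
         central_subalgebra sB AH \<and>
         (\<exists>\<omega> z. is_free_basis AH \<omega> z) \<and>
         (\<forall>\<omega> z. is_free_basis AH \<omega> z \<longrightarrow>
            eq_up_to_scalar sB (discriminant AH \<omega> z) (sm (u ^ (2 * n ^ 4 * (n - 1))) 1))"
proof -
  \<comment> \<open>Both presentations are brought to the common form with parameter
    \<open>e\<close>.\<close>
  obtain e :: 'k where pres: "presented_by sA (case_uv_gen u v)
       {gen Gen_u * gen Gen_v - const \<mu> * gen Gen_v * gen Gen_u - const e}"
    and e: "e \<noteq> 0 \<Longrightarrow> lam * \<mu> ^ 2 = 1"
  proof -
    have zero: "const 0 = (0 :: (uv_gen, 'k) free_algebra)" by (simp add: const_def)
    have one: "const 1 = (1 :: (uv_gen, 'k) free_algebra)" by (simp add: const_def)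
    from assms(6) show ?thesis
    proof
      assume "quantum_plane \<mu> sA u v"
      then show ?thesis using that[of 0] by (simp add: quantum_plane_def zero)
    next
      assume A: "quantum_weyl_algebra \<mu> sA u v \<and> lam = inverse (\<mu> ^ 2)"
      have "lam * \<mu> ^ 2 = 1" using A \<open>\<mu> \<noteq> 0\<close> by simp
      then show ?thesis using that[of 1] A by (simp add: quantum_weyl_algebra_def one)
    qed
  qed
  interpret taft_smash sA u v \<mu> e n lam \<eta> H g x act sB sm
    by (intro_locales; unfold_locales)
       (use assms pres e in \<open>auto simp: presented_by_def k_algebra_def k_algebra_axioms_def vector_space_def\<close>)
  show ?thesis
    unfolding Let_def smash_invariants_eq
    using central_subalgebra_j free_basis_y discriminant_smash by blast
qed

end
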